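(* Assume the standing assumptions (a)–(d) below, and let $T\in(0,\infty)$, $\epsilon\in[0,\infty)$ satisfy $$LT^2\le \tfrac35\min\Big(\tfrac14,\ \tfrac{3}{1280\,L\tilde R^2}\Big),\qquad \epsilon\tilde L\le \frac{5}{64}\,\frac{K}{\sqrt{7/6+3/(2KT^2)}}\exp\Big(-\frac{5\tilde R}{2T}-5\Big).$$ Then for all $x,x'\in\mathbb{R}^{Nd}$, $$\mathbb{E}\Big[\frac1N\sum_{i=1}^N\rho(\mathbf X^i(x,x'),\mathbf X'^i(x,x'))\Big]\le(1-c)\frac1N\sum_{i=1}^N\rho(x^i,x'^i),\qquad c=\frac{KT^2}{156}\exp\Big(-\frac{5\tilde R}{4T}\Big).$$
   Context: Standing assumptions: $V:\mathbb{R}^d\to\mathbb{R}$, $W:\mathbb{R}^d\times\mathbb{R}^d\to\mathbb{R}$ are $C^1$, $\nabla_1W$ the gradient in the first argument, constants $L>0,K>0,\mathcal R\ge0,\tilde L\ge0$ with: (a) $V(0)=0$, $V\ge0$; (b) $|\nabla V(x)-\nabla V(y)|\le L|x-y|$; (c) $\langle x-y,\nabla V(x)-\nabla V(y)\rangle\ge K|x-y|^2+L^{-1}|\nabla V(x)-\nabla V(y)|^2$ whenever $|x-y|\ge\mathcal R$; (d) $W$ symmetric, $|\nabla_1W(x,y)-\nabla_1W(\tilde x,\tilde y)|\le\tilde L(|x-\tilde x|+|y-\tilde y|)$. $\tilde R=\sqrt{(2L+K)/(6K)}\mathcal R$ (with $1/0=\infty$), $R_1=\frac54(\tilde R+2T)$,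 $\gamma=\min(T^{-1},\tilde R^{-1}/4)$, $f(r)=\int_0^re^{-\min(R_1,s)/T}\mathrm{d}s$, $\rho(a,b)=f(|a-b|)$ for $a,b\in\mathbb{R}^d$. Points of $\mathbb{R}^{Nd}$: $x=(x^1,\dots,x^N)$. $U(x)=\sum_i\big(V(x^i)+\frac\epsilon{2N}\sum_jW(x^i,x^j)\big)$; exact flow $(q_t,p_t)(x,v)$: $\dot q^i_t=p^i_t$, $\dot p^i_t=-\nabla_iU(q_t)$, $(q_0,p_0)=(x,v)$. Particle-wise coupling of xHMC: $\mathbf X^i(x,x')=q^i_T(x,\xi)$, $\mathbf X'^i(x,x')=q^i_T(x',\eta)$, where $\xi\sim\mathcal N(0,I_{Nd})$, $\mathcal V_1,\dots,\mathcal V_N$ i.i.d. uniform on $[0,1]$ independent of $\xi$, $z^i=x^i-x'^i$, $e^i=z^i/|z^i|$ (arbitrary unit vector if $z^i=0$), $\varphi_{0,1}$ the standard normal density; if $|z^i|\ge\tilde R$ then $\eta^i=\xi^i$, otherwise $\eta^i=\xi^i+\gamma z^i$ if $\mathcal V_i\le\varphi_{0,1}(e^i\cdot\xi^i+\gamma|z^i|)/\varphi_{0,1}(e^i\cdot\xi^i)$ and $\eta^i=\xi^i-2(e^i\cdot\xi^i)e^i$ else. *)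

theory Defs
  imports "HOL-Probability.Probability"
begin

definition Rtil :: "real \<Rightarrow> real \<Rightarrow> real \<Rightarrow> real" where
  "Rtil L K R = sqrt ((2 * L + K) / (6 * K)) * R"

definition R1 :: "real \<Rightarrow> real \<Rightarrow> real \<Rightarrow> real \<Rightarrow> real" where
  "R1 L K R T = 5 / 4 * (Rtil L K R + 2 * T)"

text \<open>gamma = min(1/T, (1/Rtil)/4) with the convention 1/0 = infinity.\<close>
definition gam :: "real \<Rightarrow> real \<Rightarrow> real \<Rightarrow> real \<Rightarrow> real" where
  "gam L K R T = (if Rtil L K R = 0 then 1 / T else min (1 / T) (1 / (4 * Rtil L K R)))"

definition fconc :: "real \<Rightarrow> real \<Rightarrow> real \<Rightarrow> real \<Rightarrow> real \<Rightarrow> real" where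
  "fconc L K R T r = integral {0..r} (\<lambda>s. exp (- min (R1 L K R T) s / T))"

definition rho :: "real \<Rightarrow> real \<Rightarrow> real \<Rightarrow> real \<Rightarrow> 'a::real_normed_vector \<Rightarrow> 'a \<Rightarrow> real" where
  "rho L K R T a b = fconc L K R T (norm (a - b))"

text \<open>Particle configurations are functions from a finite index type 'n (N = CARD('n))
  into 'a (R^d, d = DIM('a)).\<close>

definition Upot :: "('a \<Rightarrow> real) \<Rightarrow> ('a \<Rightarrow> 'a \<Rightarrow> real) \<Rightarrow> real \<Rightarrow> ('n::finite \<Rightarrow> 'a) \<Rightarrow> real" where
  "Upot V W eps x = (\<Sum>i\<in>UNIV. V (x i) + eps / (2 * real CARD('n)) * (\<Sum>j\<in>UNIV. W (x i) (x j)))"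

definition gradU :: "('a::real_inner \<Rightarrow> real) \<Rightarrow> ('a \<Rightarrow> 'a \<Rightarrow> real) \<Rightarrow> real \<Rightarrow> ('n::finite \<Rightarrow> 'a) \<Rightarrow> 'n \<Rightarrow> 'a" where
  "gradU V W eps x i = (THE g. GDERIV (\<lambda>z. Upot V W eps (x(i := z))) (x i) :> g)"

definition is_ham_flow ::
  "(('n \<Rightarrow> 'a) \<Rightarrow> 'n \<Rightarrow> 'a::real_normed_vector) \<Rightarrow> ('n \<Rightarrow> 'a) \<Rightarrow> ('n \<Rightarrow> 'a)
     \<Rightarrow> ('n \<Rightarrow> real \<Rightarrow> 'a) \<Rightarrow> ('n \<Rightarrow> real \<Rightarrow> 'a) \<Rightarrow> bool" where
  "is_ham_flow G x v q p \<longleftrightarrow>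
     (\<forall>i. q i 0 = x i \<and> p i 0 = v i) \<and>
     (\<forall>i t. (q i has_vector_derivative p i t) (at t) \<and>
            (p i has_vector_derivative - G (\<lambda>j. q j t) i) (at t))"

definition ham_q ::
  "(('n \<Rightarrow> 'a) \<Rightarrow> 'n \<Rightarrow> 'a::real_normed_vector) \<Rightarrow> ('n \<Rightarrow> 'a) \<Rightarrow> ('n \<Rightarrow> 'a) \<Rightarrow> real \<Rightarrow> 'n \<Rightarrow> 'a" where
  "ham_q G x v t = (\<lambda>i. (THE q. \<exists>p. is_ham_flow G x v q p) i t)"

definition std_gauss :: "'a::euclidean_space measure" where
  "std_gauss = density lborel
     (\<lambda>y. ennreal ((2 * pi) powr (- real DIM('a) / 2) * exp (- (norm y)\<^sup>2 / 2)))"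

definition noise :: "('n::finite \<Rightarrow> 'a::euclidean_space \<times> real) measure" where
  "noise = PiM UNIV (\<lambda>_. pair_measure std_gauss (uniform_measure lborel {0..1}))"

definition e_dir :: "'a::euclidean_space \<Rightarrow> 'a" where
  "e_dir z = (if z = 0 then (SOME b. b \<in> Basis) else z /\<^sub>R norm z)"

definition eta_coup :: "real \<Rightarrow> real \<Rightarrow> real \<Rightarrow> real \<Rightarrow> ('n \<Rightarrow> 'a::euclidean_space)
    \<Rightarrow> ('n \<Rightarrow> 'a) \<Rightarrow> ('n \<Rightarrow> 'a \<times> real) \<Rightarrow> 'n \<Rightarrow> 'a" where
  "eta_coup L K R T x x' \<omega> i =
    (let xi = fst (\<omega> i); u = snd (\<omega> i); z = x i - x' i; e = e_dir z in
     if norm z \<ge> Rtil L K R then xi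
     else if u \<le> std_normal_density (e \<bullet> xi + gam L K R T * norm z) / std_normal_density (e \<bullet> xi)
       then xi + gam L K R T *\<^sub>R z
       else xi - (2 * (e \<bullet> xi)) *\<^sub>R e)"

definition coupX :: "('a::euclidean_space \<Rightarrow> real) \<Rightarrow> ('a \<Rightarrow> 'a \<Rightarrow> real) \<Rightarrow> real \<Rightarrow> real
    \<Rightarrow> ('n::finite \<Rightarrow> 'a) \<Rightarrow> ('n \<Rightarrow> 'a \<times> real) \<Rightarrow> 'n \<Rightarrow> 'a" where
  "coupX V W eps T x \<omega> = ham_q (gradU V W eps) x (\<lambda>i. fst (\<omega> i)) T"

definition coupX' :: "('a::euclidean_space \<Rightarrow> real) \<Rightarrow> ('a \<Rightarrow> 'a \<Rightarrow> real) \<Rightarrow> real \<Rightarrow> real \<Rightarrow> real \<Rightarrow> real \<Rightarrow> real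
    \<Rightarrow> ('n::finite \<Rightarrow> 'a) \<Rightarrow> ('n \<Rightarrow> 'a) \<Rightarrow> ('n \<Rightarrow> 'a \<times> real) \<Rightarrow> 'n \<Rightarrow> 'a" where
  "coupX' V W eps L K R T x x' \<omega> = ham_q (gradU V W eps) x' (eta_coup L K R T x x' \<omega>) T"

end

theory Submission
  imports Defs
begin

text \<open>Let \<open>Z\<close> and \<open>P\<close> be the differences of positions and velocities of the two copies of a particle.
  Since \<open>L T^2\<close> is small, \<open>Z\<close> at time \<open>T\<close> is the free motion \<open>Z 0 + T P 0\<close> up to a small
  multiple of the size \<open>M\<close> of the free motion, plus a mean-field error \<open>Q\<close> that is linear in
  \<open>M\<close> and in its average over the particles; averaging over the particles turns the sum of the
  errors into a small multiple of the sum of the \<open>M\<close>.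

  Particles at distance at least \<open>Rtil\<close> move synchronously and contract by co-coercivity.
  Particles at distance \<open>r < Rtil\<close> either contract by \<open>\<gamma> T r\<close>, or are reflected with probability
  of order \<open>\<gamma> r\<close>, and then \<open>f\<close> grows by about \<open>T f'(r)\<close> at most because \<open>f\<close> is concave with
  exponentially decaying slope. The gain exceeds the loss in expectation. The hypothesis on
  \<open>\<epsilon>\<close> makes the interaction error negligible against both gains.\<close>

section \<open>Global flows of Lipschitz vector fields\<close>

text \<open>The constants form one budget. The slope of \<open>f\<close> falls from 1 at 0 to
  \<open>\<theta>\<close> = exp (- 5 \<open>Rt\<close> / (4 T)) exp (- 5/2) from \<open>R1\<close>
  on. Since exp (5/2) lies between 12 and 13, \<open>\<theta>\<close> is at most a twelfth of the
  slope at any r <= \<open>Rt\<close>, and 156 = 12 * 13 is what the final rate loses. The factor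
  5/4 in \<open>R1\<close> leaves room for the deviation from free motion. A far particle gains only
  K T^2 \<open>\<theta>\<close> / 3 of its distance, while interaction errors may be charged at
  slope 1. So eps Lt T^2 must carry the factor K T^2 \<open>\<theta>\<close>; the second
  \<open>\<theta>\<close> in its bound, at most 1/12, supplies the numerical margin. For a near
  particle, in units of \<gamma> T r exp (- r / T), translation gains 9/10 and reflection together
  with interaction costs less than 17/20 in expectation. The flow is given by a definite description
  over all real times, so nothing can be said about it before global existence and uniqueness are
  known.\<close>

lemma continuous_imp_antiderivative:
  fixes g :: "real \<Rightarrow> 'b::euclidean_space"
  assumes cont: "continuous_on UNIV g"
  shows "\<exists>G. G 0 = 0 \<and> (\<forall>t. (G has_vector_derivative g t) (at t))"
proof -
  define G where "G t = integral {0..t} g - integral {t..0} g" for t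
  have int: "g integrable_on {a..b}" for a b
    by (rule integrable_continuous_real) (rule continuous_on_subset[OF cont], simp)
  \<comment> \<open>The base point moves to \<open>-n\<close> so that \<open>t\<close> is interior
    to the interval on which the fundamental theorem is applied.\<close>
  have eq: "G t = integral {-n..t} g - integral {-n..0} g" if "-n \<le> t" "n > 0" for t n
  proof (cases "t \<ge> 0")
    case True
    have "integral {-n..0} g + integral {0..t} g = integral {-n..t} g"
      using True that int by (intro Henstock_Kurzweil_Integration.integral_combine) auto
    moreover have "integral {t..0} g = 0"
      using True by (cases "t = 0") auto
    ultimately show ?thesis by (simp add: G_def algebra_simps)
  next
    case False
    have "integral {-n..t} g + integral {t..0} g = integral {-n..0} g"
      using False that int by (intro Henstock_Kurzweil_Integration.integral_combine) auto
    moreover have "integral {0..t} g = 0"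
      using False by auto
    ultimately show ?thesis by (simp add: G_def algebra_simps)
  qed
  have "(G has_vector_derivative g t) (at t)" for t
  proof -
    define n where "n = \<bar>t\<bar> + 1"
    have "((\<lambda>t. integral {-n..t} g) has_vector_derivative g t) (at t within {-n..n})"
      by (rule integral_has_vector_derivative)
         (auto intro: continuous_on_subset[OF cont] simp: n_def)
    hence "((\<lambda>t. integral {-n..t} g - integral {-n..0} g) has_vector_derivative g t) (at t within {-n..n})"
      by (auto intro!: derivative_eq_intros)
    hence "((\<lambda>t. integral {-n..t} g - integral {-n..0} g) has_vector_derivative g t) (at t within {-n<..<n})"
      by (rule has_vector_derivative_within_subset) auto
    hence "((\<lambda>t. integral {-n..t} g - integral {-n..0} g) has_vector_derivative g t) (at t)"
      by (subst (asm) has_vector_derivative_within_open) (auto simp: n_def)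
    then show ?thesis
      by (rule has_vector_derivative_transform_within_open[where S = "{-n<..<n}"])
         (use eq[of n] in \<open>auto simp: n_def\<close>)
  qed
  moreover have "G 0 = 0" by (simp add: G_def)
  ultimately show ?thesis by blast
qed

lemma has_vector_derivative_comp_uminus:
  assumes "(h has_vector_derivative d) (at (- t))"
  shows "(h \<circ> uminus has_vector_derivative - d) (at t)"
  using vector_diff_chain_at[of uminus "-1" t h d] assms
  by (simp add: has_vector_derivative_minus[OF has_vector_derivative_id])

lemma has_real_derivative_inner:
  fixes u v :: "real \<Rightarrow> 'b::real_inner"
  assumes "(u has_vector_derivative u') (at t)" "(v has_vector_derivative v') (at t)"
  shows "((\<lambda>t. u t \<bullet> v t) has_real_derivative u t \<bullet> v' + u' \<bullet> v t) (at t)"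
  unfolding has_real_derivative_iff_has_vector_derivative has_vector_derivative_def
  by (rule has_derivative_eq_rhs, rule has_derivative_inner)
     (use assms in \<open>auto simp: has_vector_derivative_def algebra_simps\<close>)

text \<open>Integration preserves the growth rate \<open>l\<close> and gains the factor
  \<open>1 / l\<close>; this gain is what makes the Picard map contract. Negative times follow by
  time reversal.\<close>

lemma norm_primitive_le_exp:
  fixes H :: "real \<Rightarrow> 'b::real_normed_vector"
  assumes "H 0 = 0" and der: "\<And>t. (H has_vector_derivative h t) (at t)"
    and bound: "\<And>t. norm (h t) \<le> C * exp (l * \<bar>t\<bar>)" and "l > 0"
  shows "norm (H t) \<le> C / l * exp (l * \<bar>t\<bar>)"
proof -
  have C: "C \<ge> 0" using order_trans[OF norm_ge_zero bound[of 0]] by simp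
  have pos: "norm (H t) \<le> C / l * exp (l * \<bar>t\<bar>)"
    if "H 0 = 0" "\<And>t. (H has_vector_derivative h t) (at t)"
      "\<And>t. norm (h t) \<le> C * exp (l * \<bar>t\<bar>)" "t \<ge> 0" for t and H h :: "real \<Rightarrow> 'b"
  proof (cases "t = 0")
    case True
    then show ?thesis using that C \<open>l > 0\<close> by simp
  next
    case False
    have "norm (H t - H 0) \<le> C / l * exp (l * t) - C / l * exp (l * 0)"
    proof (rule differentiable_bound_general[where f' = h and \<phi>' = "\<lambda>t. C * exp (l * t)"])
      show "0 < t" using False that by simp
      show "continuous_on {0..t} H"
        by (meson continuous_at_imp_continuous_on has_vector_derivative_continuous that(2))
      show "continuous_on {0..t} (\<lambda>a. C / l * exp (l * a))"
        by (intro continuous_intros)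
      show "(H has_vector_derivative h s) (at s)" for s by (rule that)
      show "((\<lambda>a. C / l * exp (l * a)) has_vector_derivative C * exp (l * s)) (at s)" for s
        using \<open>l > 0\<close> by (auto intro!: derivative_eq_intros simp: has_real_derivative_iff_has_vector_derivative[symmetric])
      show "norm (h s) \<le> C * exp (l * s)" if "0 < s" for s
        using \<open>norm (h s) \<le> C * exp (l * \<bar>s\<bar>)\<close> that by simp
    qed
    also have "\<dots> \<le> C / l * exp (l * t)" using C \<open>l > 0\<close> by simp
    finally show ?thesis using that by simp
  qed
  show ?thesis
  proof (cases "t \<ge> 0")
    case True
    then show ?thesis using pos[OF assms(1) der bound] by blast
  next
    case False
    have "norm ((H \<circ> uminus) (- t)) \<le> C / l * exp (l * \<bar>- t\<bar>)"
    proof (rule pos[where h = "\<lambda>t. - h (- t)"])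
      show "(H \<circ> uminus has_vector_derivative - h (- t)) (at t)" for t
        by (rule has_vector_derivative_comp_uminus[OF der])
      show "norm (- h (- s)) \<le> C * exp (l * \<bar>s\<bar>)" for s using bound[of "-s"] by simp
    qed (use assms False in auto)
    then show ?thesis by simp
  qed
qed

text \<open>Picard iteration in a weighted sup norm (Bielecki): a candidate is exp (l |t|) times a
  bounded continuous \<open>u\<close>, so one fixed point covers the whole line and no local
  solutions need gluing.\<close>

lemma lipschitz_flow_exists:
  fixes F :: "'b::euclidean_space \<Rightarrow> 'b"
  assumes lip: "\<And>a b. norm (F a - F b) \<le> M * norm (a - b)" and M: "M \<ge> 0"
  shows "\<exists>y. y 0 = y0 \<and> (\<forall>t. (y has_vector_derivative F (y t)) (at t))"
proof -
  \<comment> \<open>The Picard map has Lipschitz constant \<open>M / l\<close> in the weighted norm;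
    this \<open>l\<close> keeps it below 1/2 and is positive even for \<open>M = 0\<close>.\<close>
  define l where "l = 2 * M + 1"
  have l: "l > 0" using M by (simp add: l_def)
  have contF: "continuous_on UNIV F"
  proof -
    have "M-lipschitz_on UNIV F" by (rule lipschitz_onI) (use lip M in \<open>auto simp: dist_norm\<close>)
    then show ?thesis by (rule lipschitz_on_continuous_on)
  qed
  define g where "g u s = F (exp (l * \<bar>s\<bar>) *\<^sub>R apply_bcontfun u s)" for u :: "real \<Rightarrow>\<^sub>C 'b" and s
  have contg: "continuous_on UNIV (g u)" for u
    unfolding g_def by (intro continuous_on_compose2[OF contF] continuous_intros) auto
  define I where "I u = (SOME G. G 0 = 0 \<and> (\<forall>t. (G has_vector_derivative g u t) (at t)))" for u
  have I0: "I u 0 = 0" and Id: "(I u has_vector_derivative g u t) (at t)" for u t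
    using someI_ex[OF continuous_imp_antiderivative[OF contg[of u]]] unfolding I_def by blast+
  define P where "P u t = exp (- (l * \<bar>t\<bar>)) *\<^sub>R (y0 + I u t)" for u t
  have contI: "continuous_on UNIV (I u)" for u
    by (meson continuous_at_imp_continuous_on has_vector_derivative_continuous Id)
  have contP: "continuous_on UNIV (P u)" for u
    unfolding P_def by (intro continuous_intros contI)
  have bndg: "norm (g u t) \<le> (norm (F 0) + M * norm u) * exp (l * \<bar>t\<bar>)" for u t
  proof -
    have "norm (g u t) \<le> norm (F 0) + norm (g u t - F 0)" by norm
    also have "norm (g u t - F 0) \<le> M * (exp (l * \<bar>t\<bar>) * norm (apply_bcontfun u t))"
      using lip[of "exp (l * \<bar>t\<bar>) *\<^sub>R apply_bcontfun u t" 0] by (simp add: g_def)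
    also have "\<dots> \<le> M * (exp (l * \<bar>t\<bar>) * norm u)"
      by (intro mult_left_mono norm_bounded M) auto
    also have "norm (F 0) \<le> norm (F 0) * exp (l * \<bar>t\<bar>)"
      using l mult_left_mono[of 1 "exp (l * \<bar>t\<bar>)" "norm (F 0)"] by auto
    finally show ?thesis by (simp add: algebra_simps)
  qed
  have bndP: "norm (P u t) \<le> norm y0 + (norm (F 0) + M * norm u) / l" for u t
  proof -
    have "norm (I u t) \<le> (norm (F 0) + M * norm u) / l * exp (l * \<bar>t\<bar>)"
      by (rule norm_primitive_le_exp[OF I0 Id bndg l])
    hence "exp (- (l * \<bar>t\<bar>)) * norm (I u t) \<le> exp (- (l * \<bar>t\<bar>)) * ((norm (F 0) + M * norm u) / l * exp (l * \<bar>t\<bar>))"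
      by (intro mult_left_mono) auto
    also have "\<dots> = (norm (F 0) + M * norm u) / l"
      by (simp add: exp_minus)
    finally have 1: "exp (- (l * \<bar>t\<bar>)) * norm (I u t) \<le> (norm (F 0) + M * norm u) / l" .
    have 2: "exp (- (l * \<bar>t\<bar>)) * norm y0 \<le> 1 * norm y0"
      using l by (intro mult_right_mono) auto
    have "norm (P u t) \<le> exp (- (l * \<bar>t\<bar>)) * (norm y0 + norm (I u t))"
      by (simp add: P_def norm_triangle_ineq)
    then show ?thesis using 1 2 by (simp add: algebra_simps)
  qed
  define \<Phi> where "\<Phi> u = Bcontfun (P u)" for u
  have ap: "apply_bcontfun (\<Phi> u) = P u" for u
    unfolding \<Phi>_def by (rule Bcontfun_inverse) (rule bcontfun_normI[OF contP bndP])
  have "\<exists>!u. \<Phi> u = u"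
  proof (rule banach_fix_type[of "1/2"])
    show "\<forall>u v. dist (\<Phi> u) (\<Phi> v) \<le> 1/2 * dist u v"
    proof (intro allI dist_bound)
      fix u v t
      have "norm ((\<lambda>t. I u t - I v t) t) \<le> M * dist u v / l * exp (l * \<bar>t\<bar>)"
      proof (rule norm_primitive_le_exp[where h = "\<lambda>t. g u t - g v t"])
        show "((\<lambda>t. I u t - I v t) has_vector_derivative g u t - g v t) (at t)" for t
          by (intro derivative_intros Id)
        show "norm (g u t - g v t) \<le> M * dist u v * exp (l * \<bar>t\<bar>)" for t
        proof -
          have "norm (g u t - g v t) \<le> M * (exp (l * \<bar>t\<bar>) * dist (apply_bcontfun u t) (apply_bcontfun v t))"
            using lip[of "exp (l * \<bar>t\<bar>) *\<^sub>R apply_bcontfun u t" "exp (l * \<bar>t\<bar>) *\<^sub>R apply_bcontfun v t"]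
            by (simp add: g_def dist_norm scaleR_diff_right[symmetric])
          also have "\<dots> \<le> M * (exp (l * \<bar>t\<bar>) * dist u v)"
            by (intro mult_left_mono dist_bounded M) auto
          finally show ?thesis by (simp add: algebra_simps)
        qed
      qed (use I0 l in auto)
      hence "exp (- (l * \<bar>t\<bar>)) * norm (I u t - I v t) \<le> exp (- (l * \<bar>t\<bar>)) * (M * dist u v / l * exp (l * \<bar>t\<bar>))"
        by (intro mult_left_mono) auto
      also have "\<dots> = M / l * dist u v" by (simp add: exp_minus field_simps)
      also have "\<dots> \<le> 1/2 * dist u v"
        using M by (intro mult_right_mono) (auto simp: l_def field_simps)
      finally show "dist (apply_bcontfun (\<Phi> u) t) (apply_bcontfun (\<Phi> v) t) \<le> 1/2 * dist u v"
        by (simp add: ap P_def dist_norm scaleR_diff_right[symmetric])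
    qed
  qed auto
  then obtain u where u: "\<Phi> u = u" by blast
  define y where "y t = y0 + I u t" for t
  have "exp (l * \<bar>t\<bar>) *\<^sub>R apply_bcontfun u t = y t" for t
    using ap[of u] u by (simp add: P_def y_def exp_minus)
  hence "(y has_vector_derivative F (y t)) (at t)" for t
    unfolding y_def using Id[of u t] by (auto intro!: derivative_eq_intros simp: g_def y_def)
  moreover have "y 0 = y0" by (simp add: y_def I0)
  ultimately show ?thesis by blast
qed

text \<open>Gronwall in squared form: the squared distance times exp (- 2 M t) is nonincreasing and
  starts at 0. Negative times are handled by reversing the field.\<close>

lemma lipschitz_flow_unique:
  fixes F :: "'b::euclidean_space \<Rightarrow> 'b"
  assumes lip: "\<And>a b. norm (F a - F b) \<le> M * norm (a - b)"
    and y: "\<And>t. (y has_vector_derivative F (y t)) (at t)"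
    and w: "\<And>t. (w has_vector_derivative F (w t)) (at t)" and "y 0 = w 0"
  shows "y t = w t"
proof -
  have pos: "y t = w t"
    if lip: "\<And>a b. norm (F a - F b) \<le> M * norm (a - b)"
      and y: "\<And>t. (y has_vector_derivative F (y t)) (at t)"
      and w: "\<And>t. (w has_vector_derivative F (w t)) (at t)" and "y 0 = w 0" "t \<ge> 0"
    for F :: "'b \<Rightarrow> 'b" and y w t
  proof -
    define n where "n t = ((y t - w t) \<bullet> (y t - w t)) * exp (- 2 * M * t)" for t
    have "n t \<le> n 0"
    proof (rule DERIV_nonpos_imp_nonincreasing[OF \<open>t \<ge> 0\<close>])
      fix s
      have "((\<lambda>t. y t - w t) has_vector_derivative F (y s) - F (w s)) (at s)"
        by (intro derivative_intros y w)
      note d = has_real_derivative_inner[OF this this]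
      have "(n has_real_derivative (2 * ((y s - w s) \<bullet> (F (y s) - F (w s)))
               - 2 * M * ((y s - w s) \<bullet> (y s - w s))) * exp (- 2 * M * s)) (at s)"
        unfolding n_def
        by (rule derivative_eq_intros d refl)+
           (simp add: inner_commute algebra_simps)
      moreover have "(y s - w s) \<bullet> (F (y s) - F (w s)) \<le> M * ((y s - w s) \<bullet> (y s - w s))"
      proof -
        have "(y s - w s) \<bullet> (F (y s) - F (w s)) \<le> norm (y s - w s) * norm (F (y s) - F (w s))"
          by (rule norm_cauchy_schwarz)
        also have "\<dots> \<le> norm (y s - w s) * (M * norm (y s - w s))"
          by (intro mult_left_mono lip) auto
        finally show ?thesis by (simp add: power2_norm_eq_inner[symmetric] power2_eq_square algebra_simps)
      qed
      ultimately show "\<exists>d. (n has_real_derivative d) (at s) \<and> d \<le> 0"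
        by (intro exI conjI) (auto simp: mult_le_0_iff)
    qed
    hence "(y t - w t) \<bullet> (y t - w t) \<le> 0"
      using \<open>y 0 = w 0\<close> by (simp add: n_def mult_le_0_iff)
    then show ?thesis using inner_gt_zero_iff[of "y t - w t"] by fastforce
  qed
  show ?thesis
  proof (cases "t \<ge> 0")
    case True
    then show ?thesis using pos[OF lip y w] assms by blast
  next
    case False
    have d: "(h \<circ> uminus has_vector_derivative - F ((h \<circ> uminus) t)) (at t)"
      if "\<And>t. (h has_vector_derivative F (h t)) (at t)" for h t
      using has_vector_derivative_comp_uminus[OF that[of "- t"]] by simp
    have "(y \<circ> uminus) (- t) = (w \<circ> uminus) (- t)"
      by (rule pos[where F = "\<lambda>a. - F a", OF _ d[OF y] d[OF w]])
         (use assms False in \<open>auto simp: norm_minus_commute\<close>)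
    then show ?thesis by simp
  qed
qed

section \<open>Hamiltonian flows\<close>

lemma norm_vec_le_sum: "norm (a :: 'a::real_normed_vector ^ 'n) \<le> (\<Sum>i\<in>UNIV. norm (a $ i))"
  unfolding norm_vec_def by (rule L2_set_le_sum) auto

lemma has_vector_derivative_vec_lambda:
  fixes f :: "'n::finite \<Rightarrow> real \<Rightarrow> 'a::euclidean_space"
  assumes "\<And>i. (f i has_vector_derivative f' i) (at t)"
  shows "((\<lambda>t. \<chi> i. f i t) has_vector_derivative (\<chi> i. f' i)) (at t)"
proof -
  have eq: "(\<chi> i. g i) = (\<Sum>i\<in>UNIV. axis i (g i))" for g :: "'n \<Rightarrow> 'a"
    by (simp add: vec_eq_iff axis_def if_distrib[of "\<lambda>f. f _"] sum.delta cong: if_cong)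
  have bl: "bounded_linear (axis i :: 'a \<Rightarrow> 'a ^ 'n)" for i
    unfolding linear_conv_bounded_linear[symmetric]
    by (rule linearI) (auto simp: axis_def vec_eq_iff)
  show ?thesis unfolding eq
    by (intro has_vector_derivative_sum bounded_linear.has_vector_derivative[OF bl] assms)
qed

text \<open>Justifies the definite description in \<open>ham_q\<close>. Configurations are functions
  and carry no norm, so the system is moved to pairs of vectors in \<open>'a^'n\<close>, where the
  Lipschitz flow lemmas apply.\<close>

lemma ham_q_is_ham_flow:
  fixes G :: "('n::finite \<Rightarrow> 'a::euclidean_space) \<Rightarrow> 'n \<Rightarrow> 'a"
  assumes lip: "\<And>x y i. norm (G x i - G y i) \<le> M * (\<Sum>j\<in>UNIV. norm (x j - y j))" and M: "M \<ge> 0"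
  shows "\<exists>q p. is_ham_flow G x v q p \<and> (\<forall>t. ham_q G x v t = (\<lambda>i. q i t))"
proof -
  define F :: "('a^'n) \<times> ('a^'n) \<Rightarrow> ('a^'n) \<times> ('a^'n)" where
    "F y = (snd y, \<chi> i. - G (\<lambda>j. fst y $ j) i)" for y
  define C where "C = 1 + M * real CARD('n) * real CARD('n)"
  have C: "C \<ge> 0" using M by (simp add: C_def)
  have lipF: "norm (F a - F b) \<le> C * norm (a - b)" for a b
  proof -
    have "norm (F a - F b) \<le> norm (fst (F a - F b)) + norm (snd (F a - F b))"
      using norm_Pair_le[of "fst (F a - F b)" "snd (F a - F b)"] unfolding prod.collapse .
    also have "norm (fst (F a - F b)) \<le> norm (a - b)"
      using norm_snd_le[of "snd (a - b)" "fst (a - b)"] unfolding prod.collapse by (simp add: F_def)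
    also have "norm (snd (F a - F b)) \<le> M * real CARD('n) * real CARD('n) * norm (a - b)"
    proof -
      have c: "norm (fst a $ j - fst b $ j) \<le> norm (a - b)" for j
        using Finite_Cartesian_Product.norm_nth_le[of "fst (a - b)" j] norm_fst_le[of "fst (a - b)" "snd (a - b)"]
        unfolding prod.collapse by simp
      have "norm (snd (F a - F b)) \<le> (\<Sum>i\<in>UNIV. norm (snd (F a - F b) $ i))"
        by (rule norm_vec_le_sum)
      also have "\<dots> \<le> (\<Sum>i\<in>(UNIV::'n set). M * (\<Sum>j\<in>(UNIV::'n set). norm (a - b)))"
      proof (rule sum_mono)
        fix i :: 'n
        have "norm (snd (F a - F b) $ i) \<le> M * (\<Sum>j\<in>UNIV. norm (fst a $ j - fst b $ j))"
          using lip[of "\<lambda>j. fst a $ j" i "\<lambda>j. fst b $ j"] by (simp add: F_def norm_minus_commute)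
        also have "\<dots> \<le> M * (\<Sum>j\<in>(UNIV::'n set). norm (a - b))"
          by (intro mult_left_mono sum_mono c M)
        finally show "norm (snd (F a - F b) $ i) \<le> M * (\<Sum>j\<in>(UNIV::'n set). norm (a - b))" .
      qed
      finally show ?thesis by (simp add: algebra_simps)
    qed
    finally show ?thesis by (simp add: C_def algebra_simps)
  qed
  obtain y where y0: "y 0 = (\<chi> i. x i, \<chi> i. v i)"
    and y: "\<And>t. (y has_vector_derivative F (y t)) (at t)"
    using lipschitz_flow_exists[OF lipF C, of "(\<chi> i. x i, \<chi> i. v i)"] by blast
  define q where "q i t = fst (y t) $ i" for i t
  define p where "p i t = snd (y t) $ i" for i t
  have flow: "is_ham_flow G x v q p"
  proof -
    have bl: "bounded_linear (\<lambda>y :: ('a^'n) \<times> ('a^'n). fst y $ i)"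
             "bounded_linear (\<lambda>y :: ('a^'n) \<times> ('a^'n). snd y $ i)" for i
      by (intro bounded_linear_compose[OF bounded_linear_vec_nth] bounded_linear_fst bounded_linear_snd)+
    show ?thesis
      unfolding is_ham_flow_def q_def p_def
      using bounded_linear.has_vector_derivative[OF bl(1) y] bounded_linear.has_vector_derivative[OF bl(2) y]
      by (auto simp: y0 F_def)
  qed
  have uniq: "q' = q" if "is_ham_flow G x v q' p'" for q' p'
  proof -
    define w where "w t = (\<chi> i. q' i t, \<chi> i. p' i t)" for t
    have d: "(q' i has_vector_derivative p' i t) (at t)"
            "(p' i has_vector_derivative - G (\<lambda>j. q' j t) i) (at t)" for i t
      using that by (auto simp: is_ham_flow_def)
    have "(w has_vector_derivative F (w t)) (at t)" for t
      using has_vector_derivative_Pair[OF has_vector_derivative_vec_lambda[OF d(1)] has_vector_derivative_vec_lambda[OF d(2)]]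
      by (simp add: w_def[abs_def] F_def)
    moreover have "y 0 = w 0" using that by (simp add: y0 w_def is_ham_flow_def)
    ultimately have "y t = w t" for t
      using lipschitz_flow_unique[OF lipF y] by blast
    then show ?thesis by (auto simp: q_def w_def fun_eq_iff)
  qed
  have "(THE q. \<exists>p. is_ham_flow G x v q p) = q"
    using flow uniq by (intro the_equality) blast+
  then show ?thesis using flow by (auto simp: ham_q_def)
qed

section \<open>The gradient of the mean-field potential\<close>

lemma GDERIV_unique:
  assumes "GDERIV f x :> a" "GDERIV f x :> b"
  shows "a = b"
proof -
  have "(\<lambda>h. h \<bullet> a) = (\<lambda>h. h \<bullet> b)"
    using assms has_derivative_unique unfolding gderiv_def by blast
  hence "h \<bullet> a = h \<bullet> b" for h by meson
  then show ?thesis using vector_eq_ldot by blast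
qed

lemma GDERIV_sum:
  assumes "\<And>i. i \<in> I \<Longrightarrow> GDERIV (f i) x :> d i"
  shows "GDERIV (\<lambda>x. \<Sum>i\<in>I. f i x) x :> (\<Sum>i\<in>I. d i)"
  using assms unfolding gderiv_def inner_sum_right by (rule has_derivative_sum)

text \<open>The mean-field gradient picks up the diagonal term \<open>j = i\<close> twice, which is why
  differentiability of \<open>W\<close> in both arguments jointly is needed.\<close>

lemma GDERIV_diagonal:
  fixes W :: "'a::euclidean_space \<Rightarrow> 'a \<Rightarrow> real"
  assumes dW: "\<And>y w. GDERIV (\<lambda>z. W z w) y :> gW y w"
    and C1W: "\<And>y w. (\<lambda>p. W (fst p) (snd p)) differentiable (at (y, w))"
    and sym: "\<And>y w. W y w = W w y"
  shows "GDERIV (\<lambda>z. W z z) y :> gW y y + gW y y"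
proof -
  obtain D where D: "((\<lambda>p. W (fst p) (snd p)) has_derivative D) (at (y, y))"
    using C1W unfolding differentiable_def by blast
  interpret D: bounded_linear D using D by (rule has_derivative_bounded_linear)
  have "((\<lambda>z. W z y) has_derivative (\<lambda>h. D (h, 0))) (at y)"
    using has_derivative_compose[OF has_derivative_Pair[OF has_derivative_ident has_derivative_const], of "\<lambda>p. W (fst p) (snd p)" D y y] D by simp
  hence 1: "D (h, 0) = h \<bullet> gW y y" for h
    using fun_cong[OF has_derivative_unique[OF _ dW[of y y, unfolded gderiv_def]]] by blast
  have "((\<lambda>z. W z y) has_derivative (\<lambda>h. D (0, h))) (at y)"
    using has_derivative_compose[OF has_derivative_Pair[OF has_derivative_const has_derivative_ident], of "\<lambda>p. W (fst p) (snd p)" D y y] D by (simp add: sym[of _ y])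
  hence 2: "D (0, h) = h \<bullet> gW y y" for h
    using fun_cong[OF has_derivative_unique[OF _ dW[of y y, unfolded gderiv_def]]] by blast
  have "((\<lambda>z. W z z) has_derivative (\<lambda>h. D (h, h))) (at y)"
    using has_derivative_compose[OF has_derivative_Pair[OF has_derivative_ident has_derivative_ident], of "\<lambda>p. W (fst p) (snd p)" D y] D by simp
  moreover have "D (h, h) = h \<bullet> (gW y y + gW y y)" for h
    using D.add[of "(h, 0)" "(0, h)"] by (simp add: 1 2 inner_add_right)
  ultimately show ?thesis unfolding gderiv_def by simp
qed

text \<open>Particle \<open>i\<close> enters the double sum once as a row and once as a column. By
  symmetry both contribute the same, which cancels the 1/2 in
  \<open>eps / (2 * real CARD('n))\<close>.\<close>

lemma gradU_eq:
  fixes V :: "'a::euclidean_space \<Rightarrow> real" and x :: "'n::finite \<Rightarrow> 'a"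
  assumes dV: "\<And>y. GDERIV V y :> gV y"
    and dW: "\<And>y w. GDERIV (\<lambda>z. W z w) y :> gW y w"
    and C1W: "\<And>y w. (\<lambda>p. W (fst p) (snd p)) differentiable (at (y, w))"
    and sym: "\<And>y w. W y w = W w y"
  shows "gradU V W eps x i = gV (x i) + (eps / real CARD('n)) *\<^sub>R (\<Sum>j\<in>UNIV. gW (x i) (x j))"
    (is "_ = ?g")
proof -
  let ?c = "eps / (2 * real CARD('n))"
  have W: "GDERIV (\<lambda>z. W ((x(i := z)) k) ((x(i := z)) j)) (x i) :>
     (if k = i then gW (x i) (x j) else 0) + (if j = i then gW (x i) (x k) else 0)" for k j
  proof -
    have "GDERIV (\<lambda>z. W (x k) z) (x i) :> gW (x i) (x k)"
      using dW[of "x k" "x i"] by (simp add: sym[of "x k"])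
    then show ?thesis
      using GDERIV_diagonal[OF dW C1W sym, of "x i"] dW[of "x j" "x i"] GDERIV_const
      by auto
  qed
  have V: "GDERIV (\<lambda>z. V ((x(i := z)) k)) (x i) :> (if k = i then gV (x i) else 0)" for k
    using dV GDERIV_const by auto
  have "GDERIV (\<lambda>z. Upot V W eps (x(i := z))) (x i) :>
    (\<Sum>k\<in>UNIV. (if k = i then gV (x i) else 0) +
       (?c *\<^sub>R (\<Sum>j\<in>UNIV. (if k = i then gW (x i) (x j) else 0) + (if j = i then gW (x i) (x k) else 0))
         + (\<Sum>j\<in>UNIV. W ((x(i := x i)) k) ((x(i := x i)) j)) *\<^sub>R 0))"
    unfolding Upot_def by (intro GDERIV_sum GDERIV_add GDERIV_mult GDERIV_const V W)
  also have "(\<Sum>k\<in>UNIV. (if k = i then gV (x i) else 0) +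
       (?c *\<^sub>R (\<Sum>j\<in>UNIV. (if k = i then gW (x i) (x j) else 0) + (if j = i then gW (x i) (x k) else 0))
         + (\<Sum>j\<in>UNIV. W ((x(i := x i)) k) ((x(i := x i)) j)) *\<^sub>R 0)) = ?g"
  proof -
    have "(\<Sum>k\<in>UNIV. \<Sum>j\<in>UNIV. (if k = i then gW (x i) (x j) else 0)) = (\<Sum>j\<in>UNIV. gW (x i) (x j))"
      by (subst sum.swap) simp
    moreover have "?c *\<^sub>R a + ?c *\<^sub>R a = (eps / real CARD('n)) *\<^sub>R a" for a :: 'a
      by (simp add: scaleR_add_left[symmetric] field_simps)
    ultimately show ?thesis
      by (simp add: sum.distrib scaleR_sum_right[symmetric] scaleR_add_right)
  qed
  finally have "GDERIV (\<lambda>z. Upot V W eps (x(i := z))) (x i) :> ?g" .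
  then show ?thesis
    unfolding gradU_def using GDERIV_unique by (intro the_equality) blast+
qed

section \<open>The concave distance function\<close>

lemma exp_min_integrable: "(\<lambda>s. exp (- min P s / T)) integrable_on {a..b::real}"
  by (cases "T = 0") (auto intro!: integrable_continuous_real continuous_intros)

lemma fconc_diff:
  assumes "0 \<le> a" "a \<le> b"
  shows "fconc L K R T b - fconc L K R T a = integral {a..b} (\<lambda>s. exp (- min (R1 L K R T) s / T))"
  using Henstock_Kurzweil_Integration.integral_combine[OF assms exp_min_integrable[of "R1 L K R T" T]]
  by (simp add: fconc_def)

text \<open>Concavity: the integrand of \<open>fconc\<close> is nonincreasing, so the graph lies
  below its tangent at \<open>r\<close>, on either side.\<close>

lemma fconc_tangent:
  assumes "T > 0" "0 \<le> r" "0 \<le> y"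
  shows "fconc L K R T y \<le> fconc L K R T r + exp (- min (R1 L K R T) r / T) * (y - r)"
proof (cases "r \<le> y")
  case True
  have "integral {r..y} (\<lambda>s. exp (- min (R1 L K R T) s / T))
      \<le> integral {r..y} (\<lambda>s. exp (- min (R1 L K R T) r / T))"
    using assms by (intro integral_le exp_min_integrable) (auto simp: divide_right_mono)
  then show ?thesis
    using fconc_diff[of r y L K R T] assms True by (simp add: algebra_simps)
next
  case False
  have "integral {y..r} (\<lambda>s. exp (- min (R1 L K R T) r / T))
      \<le> integral {y..r} (\<lambda>s. exp (- min (R1 L K R T) s / T))"
    using assms by (intro integral_le exp_min_integrable) (auto simp: divide_right_mono)
  then show ?thesis
    using fconc_diff[of y r L K R T] assms False by (simp add: algebra_simps)
qed

lemma fconc_R1: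
  assumes "T > 0" "0 \<le> r" "r \<le> R1 L K R T"
  shows "fconc L K R T (R1 L K R T) = fconc L K R T r + T * (exp (- r / T) - exp (- R1 L K R T / T))"
proof -
  let ?P = "R1 L K R T"
  have "((\<lambda>s. exp (- s / T)) has_integral (- T * exp (- ?P / T) - (- T * exp (- r / T)))) {r..?P}"
    using assms
    by (intro fundamental_theorem_of_calculus)
       (auto intro!: derivative_eq_intros simp: has_real_derivative_iff_has_vector_derivative[symmetric])
  moreover have "integral {r..?P} (\<lambda>s. exp (- min ?P s / T)) = integral {r..?P} (\<lambda>s. exp (- s / T))"
    by (intro Henstock_Kurzweil_Integration.integral_cong) auto
  ultimately show ?thesis
    using fconc_diff[OF assms(2,3)] by (simp add: integral_unique algebra_simps)
qed

lemma fconc_nonneg: "0 \<le> fconc L K R T r"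
  unfolding fconc_def by (rule integral_nonneg[OF exp_min_integrable]) simp

lemma fconc_le:
  assumes "T > 0" "R1 L K R T \<ge> 0" "0 \<le> r"
  shows "fconc L K R T r \<le> r"
  using fconc_tangent[of T 0 r L K R] assms by (simp add: fconc_def)

text \<open>The summand 2 T in \<open>R1\<close> contributes 5/2 to \<open>R1\<close> / T. Squaring
  turns exp (5/2) into the fifth power of e, where decimal bounds on e suffice.\<close>

lemma exp_five_halves: "12 \<le> exp (5/2 :: real)" "exp (5/2 :: real) \<le> 13"
proof -
  have e: "exp (1::real) \<le> 2.72" using e_less_272 by simp
  have sq: "(exp (5/2 :: real))\<^sup>2 = exp 1 ^ 5"
    by (simp flip: exp_of_nat_mult)
  have "(2.71 :: real) ^ 5 \<le> exp 1 ^ 5" using e_approx_32[unfolded abs_le_iff]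
    by (intro power_mono) auto
  hence "12\<^sup>2 \<le> (exp (5/2 :: real))\<^sup>2" unfolding sq by (simp add: power_numeral_reduce)
  then show "12 \<le> exp (5/2 :: real)" by (rule power2_le_imp_le) simp
  have "exp 1 ^ 5 \<le> (2.72 :: real) ^ 5" using e by (intro power_mono) auto
  hence "(exp (5/2 :: real))\<^sup>2 \<le> 13\<^sup>2" unfolding sq by (simp add: power_numeral_reduce)
  then show "exp (5/2 :: real) \<le> 13" by (rule power2_le_imp_le) simp
qed

section \<open>Contraction of coupled trajectories\<close>

lemma second_order_taylor_bound:
  fixes Z P :: "real \<Rightarrow> 'a::real_normed_vector"
  assumes Z: "\<And>t. (Z has_vector_derivative P t) (at t)"
    and P: "\<And>t. (P has_vector_derivative A t) (at t)"
    and A: "\<And>t. 0 \<le> t \<Longrightarrow> t \<le> T \<Longrightarrow> norm (A t) \<le> C" and s: "0 \<le> s" "s \<le> T"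
  shows "norm (Z s - Z 0 - s *\<^sub>R P 0) \<le> C * s\<^sup>2 / 2"
proof -
  have C: "C \<ge> 0" using order_trans[OF norm_ge_zero A[of 0]] s by simp
  have 1: "norm (P t - P 0) \<le> C * t" if "0 \<le> t" "t \<le> T" for t
  proof (cases "t = 0")
    case False
    have "norm (P t - P 0) \<le> C * t - C * 0"
    proof (rule differentiable_bound_general[where f' = A and \<phi>' = "\<lambda>t. C"])
      show "continuous_on {0..t} P"
        by (meson continuous_at_imp_continuous_on has_vector_derivative_continuous P)
      show "((\<lambda>t. C * t) has_vector_derivative C) (at u)" for u
        by (auto intro!: derivative_eq_intros simp: has_real_derivative_iff_has_vector_derivative[symmetric])
    qed (use that False P A in \<open>auto intro!: continuous_intros\<close>)
    then show ?thesis by simp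
  qed (use that in simp)
  show ?thesis
  proof (cases "s = 0")
    case False
    have "norm ((Z s - s *\<^sub>R P 0) - (Z 0 - 0 *\<^sub>R P 0)) \<le> C * s\<^sup>2 / 2 - C * 0\<^sup>2 / 2"
    proof (rule differentiable_bound_general[where f' = "\<lambda>t. P t - P 0" and \<phi>' = "\<lambda>t. C * t"])
      show "continuous_on {0..s} (\<lambda>t. Z t - t *\<^sub>R P 0)"
        by (intro continuous_intros) (meson continuous_at_imp_continuous_on has_vector_derivative_continuous Z)
      show "((\<lambda>t. Z t - t *\<^sub>R P 0) has_vector_derivative P u - P 0) (at u)" for u
        by (auto intro!: derivative_eq_intros Z)
      show "((\<lambda>t. C * t\<^sup>2 / 2) has_vector_derivative C * u) (at u)" for u
        by (auto intro!: derivative_eq_intros simp: has_real_derivative_iff_has_vector_derivative[symmetric])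
    qed (use s False 1 in \<open>auto intro!: continuous_intros\<close>)
    then show ?thesis by (simp add: algebra_simps)
  qed simp
qed

text \<open>\<open>Gd\<close> and \<open>Id\<close> are the differences of the confining and of the
  interaction gradients, and \<open>e\<close> stands for eps Lt. \<open>M i\<close> may be any bound
  on the free motion over the whole interval, so that it can later be an explicit function of the
  noise.\<close>

locale coupled_trajectories =
  fixes Z P Gd Id :: "'n::finite \<Rightarrow> real \<Rightarrow> 'a::euclidean_space" and M :: "'n \<Rightarrow> real" and L e T :: real
  assumes Z: "\<And>i t. (Z i has_vector_derivative P i t) (at t)"
    and P: "\<And>i t. (P i has_vector_derivative - (Gd i t + Id i t)) (at t)"
    and Gd: "\<And>i t. norm (Gd i t) \<le> L * norm (Z i t)"
    and Id: "\<And>i t. norm (Id i t) \<le> e * (norm (Z i t) + (\<Sum>j\<in>UNIV. norm (Z j t)) / real CARD('n))"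
    and free: "\<And>i t. 0 \<le> t \<Longrightarrow> t \<le> T \<Longrightarrow> norm (Z i 0 + t *\<^sub>R P i 0) \<le> M i"
    and T: "T > 0" and L: "L > 0" and e: "e \<ge> 0"
    and LT: "L * T\<^sup>2 \<le> 3 / 20" and eT: "e * T\<^sup>2 \<le> 1 / 1000"
begin

definition avgM :: real where "avgM = (\<Sum>j\<in>UNIV. M j) / real CARD('n)"
definition Q :: "'n \<Rightarrow> real" where "Q i = e * T\<^sup>2 * (M i + avgM)"

lemma M_nonneg: "M i \<ge> 0"
  using order_trans[OF norm_ge_zero free[of 0 i]] T by simp

lemma avgM_nonneg: "avgM \<ge> 0"
  unfolding avgM_def by (intro divide_nonneg_nonneg sum_nonneg M_nonneg) auto

lemma Q_nonneg: "Q i \<ge> 0"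
  unfolding Q_def by (intro mult_nonneg_nonneg add_nonneg_nonneg M_nonneg avgM_nonneg e) auto

text \<open>Taylor's bound involves the unknown maxima \<open>B i\<close> of |Z i|: with their
  average \<open>a\<close>, B i <= M i + (L T^2 B i + e T^2 (B i + a)) / 2. Averaging over
  \<open>i\<close> closes the inequality for \<open>a\<close> alone, and inserting that bounds each
  \<open>B i\<close>.\<close>

lemma deviation_and_interaction:
  assumes t: "0 \<le> t" "t \<le> T"
  shows "norm (Z i t - Z i 0 - t *\<^sub>R P i 0) \<le> 11 / 20 * (L * T\<^sup>2) * M i + Q i"
    and "norm (Id i t) * T\<^sup>2 \<le> 6 / 5 * Q i"
proof -
  let ?l = "L * T\<^sup>2" and ?E = "e * T\<^sup>2" and ?N = "real CARD('n)"
  have N: "?N > 0" by simp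
  have lE: "0 \<le> ?l" "0 \<le> ?E" using L e by auto
  have "\<exists>s\<in>{0..T}. \<forall>t\<in>{0..T}. norm (Z i t) \<le> norm (Z i s)" for i
  proof (rule continuous_attains_sup)
    show "continuous_on {0..T} (\<lambda>t. norm (Z i t))"
      by (intro continuous_intros) (meson continuous_at_imp_continuous_on has_vector_derivative_continuous Z)
  qed (use T in auto)
  then obtain \<tau> where \<tau>: "\<And>i. \<tau> i \<in> {0..T}"
    and max: "\<And>i t. t \<in> {0..T} \<Longrightarrow> norm (Z i t) \<le> norm (Z i (\<tau> i))" by metis
  define B where "B i = norm (Z i (\<tau> i))" for i
  have B0: "B i \<ge> 0" for i by (simp add: B_def)
  define a where "a = (\<Sum>j\<in>UNIV. B j) / ?N"
  have a0: "a \<ge> 0" unfolding a_def by (intro divide_nonneg_nonneg sum_nonneg B0) auto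
  have Idb: "norm (Id i t) \<le> e * (B i + a)" if "t \<in> {0..T}" for i t
  proof -
    have "norm (Id i t) \<le> e * (norm (Z i t) + (\<Sum>j\<in>UNIV. norm (Z j t)) / ?N)" by (rule Id)
    also have "\<dots> \<le> e * (B i + a)"
      unfolding a_def B_def
      by (intro mult_left_mono add_mono divide_right_mono sum_mono max that e) auto
    finally show ?thesis .
  qed
  define C where "C i = L * B i + e * (B i + a)" for i
  have Cb: "norm (- (Gd i t + Id i t)) \<le> C i" if "0 \<le> t" "t \<le> T" for i t
  proof -
    have "norm (- (Gd i t + Id i t)) \<le> norm (Gd i t) + norm (Id i t)"
      by (simp only: norm_minus_cancel norm_triangle_ineq)
    moreover have "norm (Gd i t) \<le> L * B i"
      using order_trans[OF Gd mult_left_mono[OF max]] that L by (auto simp: B_def)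
    ultimately show ?thesis using Idb[of t i] that by (simp add: C_def)
  qed
  have dev: "norm (Z i t - Z i 0 - t *\<^sub>R P i 0) \<le> (?l * B i + ?E * (B i + a)) / 2"
    if "0 \<le> t" "t \<le> T" for i t
  proof -
    have C0: "C i \<ge> 0" unfolding C_def using B0[of i] a0 L e by auto
    have "norm (Z i t - Z i 0 - t *\<^sub>R P i 0) \<le> C i * t\<^sup>2 / 2"
      by (rule second_order_taylor_bound[OF Z P Cb that])
    also have "\<dots> \<le> C i * T\<^sup>2 / 2"
      using that C0 by (intro divide_right_mono mult_left_mono power_mono) auto
    finally show ?thesis by (simp add: C_def algebra_simps)
  qed
  have BM: "B i \<le> M i + (?l * B i + ?E * (B i + a)) / 2" for i
  proof -
    have "norm (Z i (\<tau> i)) \<le> norm (Z i 0 + \<tau> i *\<^sub>R P i 0) + norm (Z i (\<tau> i) - Z i 0 - \<tau> i *\<^sub>R P i 0)"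
      using norm_triangle_ineq[of "Z i 0 + \<tau> i *\<^sub>R P i 0" "Z i (\<tau> i) - Z i 0 - \<tau> i *\<^sub>R P i 0"] by simp
    moreover have "0 \<le> \<tau> i" "\<tau> i \<le> T" using \<tau>[of i] by auto
    ultimately show ?thesis using dev[of "\<tau> i" i] free[of "\<tau> i" i] unfolding B_def by linarith
  qed
  have "a \<le> avgM + (?l * a + ?E * (a + a)) / 2"
  proof -
    have "(\<Sum>i\<in>UNIV. B i) \<le> (\<Sum>i\<in>UNIV. M i + (?l * B i + ?E * (B i + a)) / 2)"
      by (intro sum_mono BM)
    also have "\<dots> = (\<Sum>i\<in>UNIV. M i) + (?l * (\<Sum>i\<in>UNIV. B i) + ?E * ((\<Sum>i\<in>UNIV. B i) + ?N * a)) / 2"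
      by (simp add: sum.distrib flip: sum_distrib_left sum_divide_distrib)
    finally have "?N * a \<le> ?N * avgM + (?l * (?N * a) + ?E * (?N * a + ?N * a)) / 2"
      using N by (simp add: a_def avgM_def)
    also have "\<dots> = ?N * (avgM + (?l * a + ?E * (a + a)) / 2)" by (simp add: algebra_simps)
    finally show ?thesis by (rule mult_left_le_imp_le) simp
  qed
  \<comment> \<open>Products become atoms, so the claim is linear: 1 - 3/40 - 1/1000 exceeds
    10/11.\<close>
  moreover have "\<And>u v. a \<le> avgM + (u + v * 2) / 2 \<Longrightarrow> u \<le> 3/20 * a \<Longrightarrow> v \<le> 1/1000 * a \<Longrightarrow> a \<le> 11/10 * avgM"
    using a0 avgM_nonneg by argo
  moreover have "?l * a \<le> 3/20 * a" "?E * a \<le> 1/1000 * a"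
    using mult_right_mono[OF LT a0] mult_right_mono[OF eT a0] by auto
  ultimately have aM: "a \<le> 11/10 * avgM"
    by (simp only: distrib_left mult_2_right)
  have Bi: "?l * B i \<le> 3/20 * B i" "?E * B i \<le> 1/1000 * B i"
    using mult_right_mono[OF LT B0] mult_right_mono[OF eT B0] by auto
  have Ea: "?E * a \<le> 11/10 * (?E * avgM)"
    using mult_left_mono[OF aM lE(2)] by simp
  have EA0: "?E * avgM \<ge> 0" "?E * M i \<ge> 0" using lE avgM_nonneg M_nonneg by auto
  \<comment> \<open>1 - 3/40 - 1/2000 exceeds 100/109, and (11/20) (109/100) is below 6/10.\<close>
  have B: "B i \<le> 109/100 * M i + 6/10 * (?E * avgM)"
    using BM[of i] Bi Ea EA0 M_nonneg[of i] by (simp only: distrib_left) argo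
  have lB: "?l * B i \<le> 109/100 * (?l * M i) + 6/10 * (3/20 * (?E * avgM))"
  proof -
    have "?l * B i \<le> ?l * (109/100 * M i + 6/10 * (?E * avgM))" by (rule mult_left_mono[OF B lE(1)])
    moreover have "?l * (?E * avgM) \<le> 3/20 * (?E * avgM)" by (rule mult_right_mono[OF LT EA0(1)])
    ultimately show ?thesis by (simp only: distrib_left)
  qed
  have EB: "?E * B i \<le> 109/100 * (?E * M i) + 6/10 * (1/1000 * (?E * avgM))"
  proof -
    have "?E * B i \<le> ?E * (109/100 * M i + 6/10 * (?E * avgM))" by (rule mult_left_mono[OF B lE(2)])
    moreover have "?E * (?E * avgM) \<le> 1/1000 * (?E * avgM)" by (rule mult_right_mono[OF eT EA0(1)])
    ultimately show ?thesis by (simp only: distrib_left)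
  qed
  have lM: "?l * M i \<ge> 0" using lE M_nonneg by simp
  have Qi: "Q i = ?E * M i + ?E * avgM" by (simp add: Q_def algebra_simps)
  show "norm (Z i t - Z i 0 - t *\<^sub>R P i 0) \<le> 11 / 20 * (L * T\<^sup>2) * M i + Q i"
    using dev[OF t, of i] lB EB Ea EA0 lM unfolding Qi mult.assoc[of "11/20"] distrib_left by argo
  have "norm (Id i t) * T\<^sup>2 \<le> e * (B i + a) * T\<^sup>2"
    using Idb[of t i] t by (intro mult_right_mono) auto
  also have "\<dots> = ?E * B i + ?E * a" by (simp add: algebra_simps)
  finally show "norm (Id i t) * T\<^sup>2 \<le> 6 / 5 * Q i"
    using EB Ea EA0 unfolding Qi by argo
qed

lemma deviation_T: "norm (Z i T - (Z i 0 + T *\<^sub>R P i 0)) \<le> 11 / 20 * (L * T\<^sup>2) * M i + Q i"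
  using deviation_and_interaction(1)[of T i] T by (simp add: algebra_simps)

text \<open>While the trajectories stay at distance at least \<open>R\<close>, co-coercivity lets the
  Lyapunov function \<open>2 (T - t) (Z \<bullet> P) + |Z|^2 + 4 T (T - t) |P|^2\<close> absorb the
  velocity difference. If the interaction is strong enough to push them closer than \<open>R\<close>,
  it already dominates the claimed contraction.\<close>

lemma synchronous_contraction:
  assumes conv: "\<And>t. norm (Z i t) \<ge> R \<Longrightarrow>
      Z i t \<bullet> Gd i t \<ge> K * (norm (Z i t))\<^sup>2 + (norm (Gd i t))\<^sup>2 / L"
    and P0: "P i 0 = 0" and r: "M i = norm (Z i 0)" and R: "norm (Z i 0) \<ge> 6 / 5 * R"
    and K: "K \<ge> 0" and KT: "K * T\<^sup>2 \<le> 3 / 80"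
  shows "norm (Z i T) \<le> norm (Z i 0) - K * T\<^sup>2 / 3 * norm (Z i 0) + 4 * Q i"
proof -
  define r where "r = norm (Z i 0)"
  have r0: "r \<ge> 0" by (simp add: r_def)
  have KTr: "K * T\<^sup>2 * r \<le> 3/80 * r" "0 \<le> K * T\<^sup>2 * r" using mult_right_mono[OF KT r0] r0 K by auto
  have lr: "L * T\<^sup>2 * r \<le> 3/20 * r" using mult_right_mono[OF LT r0] by simp
  have dev: "norm (Z i t - Z i 0) \<le> 33/400 * r + Q i" if "0 \<le> t" "t \<le> T" for t
    using deviation_and_interaction(1)[OF that, of i] lr P0 by (simp add: r r_def[symmetric])
  show ?thesis
  proof (cases "Q i \<ge> r / 20")
    \<comment> \<open>Here 3 Q i >= 3/20 r pays both for the deviation 33/400 r and for the claimed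
      gain, which is at most r / 80.\<close>
    case True
    have "norm (Z i T) \<le> r + norm (Z i T - Z i 0)" unfolding r_def by norm
    also have "\<dots> \<le> r + 33/400 * r + Q i" using dev[of T] T by simp
    finally show ?thesis using KTr True r0 unfolding r_def[symmetric] by simp
  next
    case False
    \<comment> \<open>The deviation is at most 33/400 r + Q i with 33/400 = (11/20) (3/20) and Q i <
      r / 20, hence 1 - 53/400 and 1 + 53/400.\<close>
    have Z_bounds: "norm (Z i t) \<ge> 347/400 * r" "norm (Z i t) \<le> 453/400 * r" if "0 \<le> t" "t \<le> T" for t
    proof -
      have "r \<le> norm (Z i t) + norm (Z i t - Z i 0)" "norm (Z i t) \<le> r + norm (Z i t - Z i 0)"
        unfolding r_def by norm+
      then show "norm (Z i t) \<ge> 347/400 * r" "norm (Z i t) \<le> 453/400 * r" using dev[OF that] False by auto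
    qed
    define j where "j = 6/5 * Q i / T\<^sup>2"
    have j0: "j \<ge> 0" using Q_nonneg by (simp add: j_def)
    have jb: "norm (Id i t) \<le> j" if "0 \<le> t" "t \<le> T" for t
      using deviation_and_interaction(2)[OF that, of i] T by (simp add: j_def field_simps)
    define c where "c = - K * (347/400 * r)\<^sup>2 + 20 * T\<^sup>2 * j\<^sup>2 + j * (453/400 * r)"
    \<comment> \<open>The last summand offsets the constant part of the rate: comparing the values
      at 0 and \<open>T\<close> yields |Z T|^2 <= r^2 + c T^2. The weight 4 T makes the coefficient
      of |P|^2 in the derivative, after Young's inequality, 4 (T - t) - 4 T <= 0.\<close>
    define \<Phi> where "\<Phi> t = (T - t) * 2 * (Z i t \<bullet> P i t) + Z i t \<bullet> Z i t
       + 4 * T * (T - t) * (P i t \<bullet> P i t) + c * (T - t)\<^sup>2" for t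
    have "\<Phi> T \<le> \<Phi> 0"
    proof (rule DERIV_nonpos_imp_nonincreasing[of 0 T \<Phi>])
      show "0 \<le> T" using T by simp
      fix t assume t: "0 \<le> t" "t \<le> T"
      let ?z = "Z i t" and ?p = "P i t" and ?g = "Gd i t" and ?j = "Id i t"
      let ?G = "?g + ?j"
      note dZP = has_real_derivative_inner[OF Z[of i t] P[of i t]]
      note dZZ = has_real_derivative_inner[OF Z[of i t] Z[of i t]]
      note dPP = has_real_derivative_inner[OF P[of i t] P[of i t]]
      have D: "(\<Phi> has_real_derivative
          (T - t) * 2 * (?p \<bullet> ?p - ?z \<bullet> ?G) - 4 * T * (?p \<bullet> ?p) - 8 * T * (T - t) * (?p \<bullet> ?G) - 2 * c * (T - t)) (at t)"
        unfolding \<Phi>_def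
        by (rule derivative_eq_intros dZP dZZ dPP refl)+
           (simp add: inner_commute inner_add_right inner_add_left algebra_simps power2_eq_square)
      have 1: "- 8 * T * (?p \<bullet> ?G) \<le> 2 * (?p \<bullet> ?p) + 8 * T\<^sup>2 * (?G \<bullet> ?G)"
      proof -
        have "0 \<le> (?p + (2 * T) *\<^sub>R ?G) \<bullet> (?p + (2 * T) *\<^sub>R ?G)" by simp
        also have "\<dots> = ?p \<bullet> ?p + 4 * T * (?p \<bullet> ?G) + 4 * T\<^sup>2 * (?G \<bullet> ?G)"
          by (simp add: inner_add_left inner_add_right inner_commute power2_eq_square algebra_simps)
        finally show ?thesis by linarith
      qed
      have 2: "?G \<bullet> ?G \<le> 5/4 * (?g \<bullet> ?g) + 5 * (?j \<bullet> ?j)"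
      proof -
        have "0 \<le> ((1/2) *\<^sub>R ?g - 2 *\<^sub>R ?j) \<bullet> ((1/2) *\<^sub>R ?g - 2 *\<^sub>R ?j)" by simp
        also have "\<dots> = 1/4 * (?g \<bullet> ?g) - 2 * (?g \<bullet> ?j) + 4 * (?j \<bullet> ?j)"
          by (simp add: inner_diff_left inner_diff_right inner_commute[of ?j ?g] field_simps)
        finally show ?thesis by (simp add: inner_add_left inner_add_right inner_commute[of ?j ?g])
      qed
      have jj: "?j \<bullet> ?j \<le> j\<^sup>2"
        using jb[OF t] by (simp add: power2_norm_eq_inner[symmetric] power_mono)
      have 3: "- (?z \<bullet> ?j) \<le> j * (453/400 * r)"
      proof -
        have "- (?z \<bullet> ?j) \<le> norm ?z * norm ?j" using norm_cauchy_schwarz[of "- ?z" ?j] by simp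
        also have "\<dots> \<le> (453/400 * r) * j" using Z_bounds[OF t] jb[OF t] r0 by (intro mult_mono) auto
        finally show ?thesis by (simp add: mult.commute)
      qed
      have 4: "?z \<bullet> ?g \<ge> K * (347/400 * r)\<^sup>2 + (?g \<bullet> ?g) / L"
      proof -
        \<comment> \<open>(347/400) (6/5) > 1: the slack between \<open>R\<close> and the initial
          distance keeps co-coercivity available up to time \<open>T\<close>.\<close>
        have "norm ?z \<ge> R" using Z_bounds(1)[OF t] R r0 unfolding r_def[symmetric] by linarith
        from conv[OF this] have "?z \<bullet> ?g \<ge> K * (norm ?z)\<^sup>2 + (?g \<bullet> ?g) / L"
          by (simp add: power2_norm_eq_inner)
        moreover have "K * (norm ?z)\<^sup>2 \<ge> K * (347/400 * r)\<^sup>2"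
          using Z_bounds(1)[OF t] r0 K by (intro mult_left_mono power_mono) auto
        ultimately show ?thesis by linarith
      qed
      have 5: "10 * T\<^sup>2 * (?g \<bullet> ?g) \<le> 2 * ((?g \<bullet> ?g) / L)"
      proof -
        have "T\<^sup>2 \<le> 1/5 * (1 / L)" using LT L by (simp add: field_simps)
        from mult_right_mono[OF this, of "?g \<bullet> ?g"] show ?thesis by simp
      qed
      have 6: "8 * T\<^sup>2 * (?G \<bullet> ?G) \<le> 10 * T\<^sup>2 * (?g \<bullet> ?g) + 40 * T\<^sup>2 * j\<^sup>2"
      proof -
        have "8 * T\<^sup>2 * (?G \<bullet> ?G) \<le> 8 * T\<^sup>2 * (5/4 * (?g \<bullet> ?g) + 5 * j\<^sup>2)"
          using 2 jj by (intro mult_left_mono) auto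
        then show ?thesis by (simp add: algebra_simps)
      qed
      have 7: "4 * (?p \<bullet> ?p) - 2 * (?z \<bullet> ?G) + - 8 * T * (?p \<bullet> ?G) - 2 * (?p \<bullet> ?p) \<le> 4 * (?p \<bullet> ?p) + 2 * c"
        using 1 3 4 5 6 unfolding c_def inner_add_right[of ?z] by argo
      have "(T - t) * (- 2 * (?z \<bullet> ?G) + - 8 * T * (?p \<bullet> ?G) + 2 * (?p \<bullet> ?p) - 4 * (?p \<bullet> ?p) - 2 * c) \<le> 0"
        using 7 t by (intro mult_nonneg_nonpos) auto
      moreover have "t * (?p \<bullet> ?p) \<ge> 0" using t by simp
      ultimately have "(T - t) * 2 * (?p \<bullet> ?p - ?z \<bullet> ?G) - 4 * T * (?p \<bullet> ?p) - 8 * T * (T - t) * (?p \<bullet> ?G) - 2 * c * (T - t) \<le> 0"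
        by (simp add: algebra_simps)
      with D show "\<exists>y. (\<Phi> has_real_derivative y) (at t) \<and> y \<le> 0" by blast
    qed
    hence "(norm (Z i T))\<^sup>2 \<le> r\<^sup>2 + c * T\<^sup>2"
      by (simp add: \<Phi>_def P0 r_def power2_norm_eq_inner)
    also have "c * T\<^sup>2 = - (K * T\<^sup>2) * (347/400 * r)\<^sup>2 + 20 * (j * T\<^sup>2)\<^sup>2 + (j * T\<^sup>2) * (453/400 * r)"
      by (simp add: c_def algebra_simps power2_eq_square)
    also have "j * T\<^sup>2 = 6/5 * Q i" using T by (simp add: j_def)
    also have "20 * (6/5 * Q i)\<^sup>2 \<le> 144/100 * (Q i * r)"
    proof -
      have "Q i * Q i \<le> Q i * (r / 20)" using False Q_nonneg by (intro mult_left_mono) auto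
      then show ?thesis by (simp add: power2_eq_square algebra_simps)
    qed
    finally have "(norm (Z i T))\<^sup>2 \<le> r\<^sup>2 - K * T\<^sup>2 * (347/400 * r)\<^sup>2 + 3 * (Q i * r)"
      using mult_nonneg_nonneg[OF Q_nonneg[of i] r0] by (simp add: algebra_simps)
    \<comment> \<open>Completing the square: (347/400)^2 > 2/3 bounds the left side by r^2 + 2 r
      d.\<close>
    also have "\<dots> \<le> (r - K * T\<^sup>2 / 3 * r + 4 * Q i)\<^sup>2"
    proof -
      define d where "d = - K * T\<^sup>2 / 3 * r + 4 * Q i"
      have "- (K * T\<^sup>2 * (347/400 * r)\<^sup>2) \<le> - (2/3) * (K * T\<^sup>2 * r\<^sup>2)"
        using K r0 T by (simp add: power_mult_distrib power2_eq_square)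
      hence "r\<^sup>2 - K * T\<^sup>2 * (347/400 * r)\<^sup>2 + 3 * (Q i * r) \<le> r\<^sup>2 + 2 * r * d"
        using mult_nonneg_nonneg[OF Q_nonneg[of i] r0] by (simp add: d_def algebra_simps power2_eq_square)
      also have "\<dots> \<le> (r + d)\<^sup>2" by (simp add: power2_sum)
      finally show ?thesis by (simp add: d_def algebra_simps)
    qed
    finally have "norm (Z i T) \<le> r - K * T\<^sup>2 / 3 * r + 4 * Q i"
      by (rule power2_le_imp_le) (use KTr r0 Q_nonneg[of i] in \<open>simp add: algebra_simps\<close>)
    then show ?thesis by (simp add: r_def)
  qed
qed

end

section \<open>One-dimensional marginals of the noise\<close>

text \<open>The Gaussian density factorises over the coordinates. In this form the coordinates are
  independent normal variables, which gives total mass 1 and the law of every linear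
  functional.\<close>

lemma std_gauss_eq_distr_PiM:
  "(std_gauss :: 'a::euclidean_space measure) =
     distr (PiM Basis (\<lambda>_. density lborel std_normal_density)) borel (\<lambda>f. \<Sum>b\<in>Basis. f b *\<^sub>R b)"
proof -
  let ?N = "density lborel std_normal_density"
  let ?B = "Basis :: 'a set"
  let ?L = "PiM ?B (\<lambda>_. lborel :: real measure)"
  let ?s = "\<lambda>f. \<Sum>b\<in>?B. f b *\<^sub>R b"
  let ?d = "\<lambda>f. \<Prod>b\<in>?B. ennreal (std_normal_density (f b))"
  interpret N: prob_space ?N using prob_space_normal_density[of 1 0] by simp
  interpret PN: product_sigma_finite "\<lambda>_ :: 'a. ?N"
    by (simp add: product_sigma_finite_def N.sigma_finite_measure_axioms)
  interpret PL: product_sigma_finite "\<lambda>_ :: 'a. lborel :: real measure"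
    by (simp add: product_sigma_finite_def sigma_finite_lborel)
  have dens: "PiM ?B (\<lambda>_. ?N) = density ?L ?d"
  proof (rule PN.PiM_eqI[symmetric])
    show "sets (density ?L ?d) = sets (PiM ?B (\<lambda>_. ?N))"
      by (simp cong: sets_PiM_cong)
    fix A assume A: "\<And>b. b \<in> ?B \<Longrightarrow> A b \<in> sets ?N"
    have "Pi\<^sub>E ?B A \<in> sets ?L" using A by (intro sets_PiM_I_finite) auto
    hence "emeasure (density ?L ?d) (Pi\<^sub>E ?B A) = (\<integral>\<^sup>+f. ?d f * indicator (Pi\<^sub>E ?B A) f \<partial>?L)"
      by (subst emeasure_density) auto
    also have "\<dots> = (\<integral>\<^sup>+f. (\<Prod>b\<in>?B. ennreal (std_normal_density (f b)) * indicator (A b) (f b)) \<partial>?L)"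
    proof (rule nn_integral_cong)
      fix f assume "f \<in> space ?L"
      hence "indicator (Pi\<^sub>E ?B A) f = (\<Prod>b\<in>?B. indicator (A b) (f b) :: ennreal)"
        by (auto simp: indicator_def space_PiM PiE_iff)
      then show "?d f * indicator (Pi\<^sub>E ?B A) f = (\<Prod>b\<in>?B. ennreal (std_normal_density (f b)) * indicator (A b) (f b))"
        by (simp add: prod.distrib)
    qed
    also have "\<dots> = (\<Prod>b\<in>?B. \<integral>\<^sup>+x. ennreal (std_normal_density x) * indicator (A b) x \<partial>lborel)"
      using A by (intro PL.product_nn_integral_prod) auto
    also have "\<dots> = (\<Prod>b\<in>?B. emeasure ?N (A b))"
      using A by (intro prod.cong refl) (simp add: emeasure_density)
    finally show "emeasure (density ?L ?d) (Pi\<^sub>E ?B A) = (\<Prod>b\<in>?B. emeasure ?N (A b))" .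
  qed simp
  let ?h = "\<lambda>y::'a. ennreal ((2 * pi) powr (- real DIM('a) / 2) * exp (- (norm y)\<^sup>2 / 2))"
  have c: "(2 * pi) powr (- real DIM('a) / 2) = (1 / sqrt (2 * pi)) ^ DIM('a)"
  proof -
    have "(2 * pi) powr (- real DIM('a) / 2) = ((2 * pi) powr (1/2)) powr (- real DIM('a))"
      by (simp add: powr_powr)
    also have "\<dots> = (1 / sqrt (2 * pi)) ^ DIM('a)"
      by (simp add: powr_half_sqrt powr_minus powr_realpow power_divide divide_simps)
    finally show ?thesis .
  qed
  have h: "?h (?s f) = ?d f" for f
  proof -
    have "(norm (?s f))\<^sup>2 = (\<Sum>b\<in>?B. (f b)\<^sup>2)"
      unfolding power2_norm_eq_inner by (subst euclidean_inner) (simp add: inner_sum_left_Basis power2_eq_square)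
    hence "exp (- (norm (?s f))\<^sup>2 / 2) = (\<Prod>b\<in>?B. exp (- (f b)\<^sup>2 / 2))"
      by (simp add: exp_sum sum_negf[symmetric] sum_divide_distrib)
    then show ?thesis
      unfolding c by (simp add: prod_ennreal std_normal_density_def prod_dividef power_divide prod.distrib)
  qed
  have ms: "?s \<in> borel_measurable ?L" by measurable
  have "std_gauss = density (distr ?L borel ?s) ?h"
    unfolding std_gauss_def by (subst lborel_eq) simp
  also have "\<dots> = distr (density ?L (\<lambda>f. ?h (?s f))) borel ?s"
    by (rule density_distr[OF _ ms]) measurable
  also have "(\<lambda>f. ?h (?s f)) = ?d" using h by blast
  finally show ?thesis unfolding dens .
qed

lemma sets_std_gauss [measurable_cong, simp]: "sets std_gauss = sets borel"
  by (simp add: std_gauss_def)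

lemma prob_space_std_gauss: "prob_space (std_gauss :: 'a::euclidean_space measure)"
  unfolding std_gauss_eq_distr_PiM
proof (rule prob_space.prob_space_distr)
  show "prob_space (PiM Basis (\<lambda>_::'a. density lborel std_normal_density))"
    using prob_space_normal_density[of 1 0] by (intro prob_space_PiM) simp
qed measurable

text \<open>A sum of independent normals with weights \<open>e \<bullet> b\<close> is normal, and
  its variance is the sum of the squared weights, |e|^2 = 1.\<close>

lemma distributed_std_gauss_inner:
  fixes e :: "'a::euclidean_space"
  assumes e: "norm e = 1"
  shows "distributed std_gauss lborel (\<lambda>\<xi>. e \<bullet> \<xi>) std_normal_density"
proof -
  let ?N = "density lborel std_normal_density"
  let ?P = "PiM Basis (\<lambda>_ :: 'a. ?N)"
  let ?s = "\<lambda>f. \<Sum>b\<in>Basis. f b *\<^sub>R (b :: 'a)"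
  have N: "prob_space ?N" using prob_space_normal_density[of 1 0] by simp
  interpret P: prob_space ?P by (intro prob_space_PiM N)
  have comp: "distr ?P ?N (\<lambda>f. f b) = ?N" if "b \<in> Basis" for b
    by (rule distr_PiM_component[OF N that])
  have ind: "P.indep_vars (\<lambda>_. ?N) (\<lambda>b f. f b) Basis"
  proof (subst P.indep_vars_iff_distr_eq_PiM')
    have "distr ?P ?P (\<lambda>x. restrict x Basis) = distr ?P ?P (\<lambda>x. x)"
      by (intro distr_cong refl) (auto simp: space_PiM)
    also have "\<dots> = PiM Basis (\<lambda>b. distr ?P ?N (\<lambda>f. f b))"
      by (simp add: comp cong: PiM_cong)
    finally show "distr ?P ?P (\<lambda>x. \<lambda>b\<in>Basis. x b) = PiM Basis (\<lambda>b. distr ?P ?N (\<lambda>f. f b))" .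
  qed auto
  \<comment> \<open>Coordinates with weight 0 are dropped because \<open>sum_indep_normal\<close>
    asks for positive deviations; \<open>I\<close> is nonempty since \<open>e\<close> is not
    0.\<close>
  define I where "I = {b \<in> Basis. e \<bullet> b \<noteq> 0}"
  have I: "finite I" "I \<noteq> {}" "I \<subseteq> Basis"
  proof -
    show "I \<noteq> {}"
    proof
      assume "I = {}"
      hence "e = 0" by (auto simp: I_def intro: euclidean_eqI)
      then show False using e by simp
    qed
  qed (auto simp: I_def)
  have "distributed ?P lborel (\<lambda>f. \<Sum>b\<in>I. 0 + (e \<bullet> b) * f b)
     (normal_density (\<Sum>b\<in>I. 0 + (e \<bullet> b) * 0) (sqrt (\<Sum>b\<in>I. (\<bar>e \<bullet> b\<bar> * 1)\<^sup>2)))"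
  proof (rule P.sum_indep_normal[OF I(1,2)])
    show "P.indep_vars (\<lambda>_. borel) (\<lambda>b f. 0 + (e \<bullet> b) * f b) I"
      by (rule P.indep_vars_compose2[OF P.indep_vars_subset[OF ind I(3)]]) simp
    fix b assume b: "b \<in> I"
    show "0 < \<bar>e \<bullet> b\<bar> * 1" using b by (simp add: I_def)
    show "distributed ?P lborel (\<lambda>f. 0 + (e \<bullet> b) * f b) (normal_density (0 + (e \<bullet> b) * 0) (\<bar>e \<bullet> b\<bar> * 1))"
    proof (rule P.normal_density_affine)
      have "distr ?P lborel (\<lambda>f. f b) = distr ?P ?N (\<lambda>f. f b)"
        by (intro distr_cong) auto
      then show "distributed ?P lborel (\<lambda>f. f b) std_normal_density"
        unfolding distributed_def using comp[of b] b I(3) by auto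
    qed (use b in \<open>auto simp: I_def\<close>)
  qed
  moreover have "(\<Sum>b\<in>I. (\<bar>e \<bullet> b\<bar> * 1)\<^sup>2) = 1"
  proof -
    have "(\<Sum>b\<in>I. (\<bar>e \<bullet> b\<bar> * 1)\<^sup>2) = (\<Sum>b\<in>Basis. (e \<bullet> b) * (e \<bullet> b))"
      unfolding I_def by (intro sum.mono_neutral_cong_left) (auto simp: power2_eq_square)
    also have "\<dots> = e \<bullet> e" by (rule euclidean_inner[symmetric])
    finally show ?thesis using e by (simp add: dot_square_norm)
  qed
  moreover have "(\<Sum>b\<in>I. 0 + (e \<bullet> b) * f b) = e \<bullet> ?s f" for f
    unfolding I_def inner_sum_right
    by (intro sum.mono_neutral_cong_left) auto
  ultimately have d: "distributed ?P lborel (\<lambda>f. e \<bullet> ?s f) std_normal_density" by simp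
  have "distr std_gauss lborel (\<lambda>\<xi>. e \<bullet> \<xi>) = distr ?P lborel (\<lambda>f. e \<bullet> ?s f)"
    unfolding std_gauss_eq_distr_PiM by (subst distr_distr) (auto simp: comp_def)
  then show ?thesis using d unfolding distributed_def by auto
qed

lemma std_normal_density_ratio:
  "std_normal_density (s + g) / std_normal_density s = exp (- (g * s + g\<^sup>2 / 2))"
proof -
  have "- (g * s + g\<^sup>2 / 2) = - (s + g)\<^sup>2 / 2 - (- s\<^sup>2 / 2)"
    by (simp add: power2_sum field_simps)
  hence "exp (- (g * s + g\<^sup>2 / 2)) = exp (- (s + g)\<^sup>2 / 2) / exp (- s\<^sup>2 / 2)"
    by (simp only: exp_diff)
  then show ?thesis by (simp add: std_normal_density_def)
qed

text \<open>The reflection probability given \<open>e \<bullet> \<xi> = s\<close> is \<open>1 - exp (- g s - g^2/2)\<close>, or zero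
  when this is negative; hence at most \<open>g (max s 0 + 1/8)\<close>.\<close>

lemma reflection_expectation:
  fixes e :: "'a::euclidean_space"
  assumes e: "norm e = 1" and g: "0 \<le> g" "g \<le> 1/4" and AB: "0 \<le> A" "0 \<le> B"
  shows "(\<integral>\<^sup>+\<omega>. ennreal (if snd \<omega> \<le> std_normal_density (e \<bullet> fst \<omega> + g) / std_normal_density (e \<bullet> fst \<omega>)
              then 0 else A + B * \<bar>e \<bullet> fst \<omega>\<bar>)
            \<partial>(std_gauss \<Otimes>\<^sub>M uniform_measure lborel {0..1}))
        \<le> ennreal (g * (21/40 * A + 11/10 * B))"
proof -
  let ?U = "uniform_measure lborel {0..1::real}"
  let ?r = "\<lambda>s. exp (- (g * s + g\<^sup>2 / 2))"
  interpret U: prob_space ?U by (rule prob_space_uniform_measure) auto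
  have "(\<integral>\<^sup>+\<omega>. ennreal (if snd \<omega> \<le> std_normal_density (e \<bullet> fst \<omega> + g) / std_normal_density (e \<bullet> fst \<omega>)
              then 0 else A + B * \<bar>e \<bullet> fst \<omega>\<bar>)
            \<partial>(std_gauss \<Otimes>\<^sub>M ?U))
      = (\<integral>\<^sup>+\<xi>. \<integral>\<^sup>+u. ennreal (if u \<le> ?r (e \<bullet> \<xi>) then 0 else A + B * \<bar>e \<bullet> \<xi>\<bar>) \<partial>?U \<partial>std_gauss)"
    unfolding std_normal_density_ratio
    by (subst U.nn_integral_fst[symmetric], measurable) (simp only: fst_conv snd_conv)
  also have "\<dots> \<le> (\<integral>\<^sup>+\<xi>. ennreal (g * (max (e \<bullet> \<xi>) 0 + 1/8) * (A + B * \<bar>e \<bullet> \<xi>\<bar>)) \<partial>std_gauss)"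
  proof (rule nn_integral_mono)
    fix \<xi> :: 'a
    define s where "s = e \<bullet> \<xi>"
    have c: "A + B * \<bar>s\<bar> \<ge> 0" using AB by simp
    have "(\<integral>\<^sup>+u. ennreal (if u \<le> ?r s then 0 else A + B * \<bar>s\<bar>) \<partial>?U)
        = (\<integral>\<^sup>+u. ennreal (A + B * \<bar>s\<bar>) * indicator {?r s<..} u \<partial>?U)"
      by (intro nn_integral_cong) (auto simp: indicator_def)
    also have "\<dots> = ennreal (A + B * \<bar>s\<bar>) * emeasure ?U {?r s<..}"
      by (subst nn_integral_cmult_indicator) auto
    also have "emeasure ?U {?r s<..} \<le> ennreal (g * (max s 0 + 1/8))"
    proof -
      have "emeasure ?U {?r s<..} = emeasure lborel ({0..1} \<inter> {?r s<..})"
        by (subst emeasure_uniform_measure) (auto simp: divide_ennreal_def)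
      also have "\<dots> \<le> emeasure lborel {?r s..1}"
        by (intro emeasure_mono) auto
      also have "\<dots> \<le> ennreal (g * (max s 0 + 1/8))"
      proof (cases "?r s \<le> 1")
        case True
        \<comment> \<open>1 - exp (- x) <= x; the summand 1/8 then comes from g^2 / 2 <= g / 8, as g
          <= 1/4.\<close>
        have "1 - ?r s \<le> g * s + g\<^sup>2 / 2"
          using exp_ge_add_one_self[of "- (g * s + g\<^sup>2 / 2)"] by linarith
        also have "\<dots> \<le> g * max s 0 + g * (1/8)"
        proof (rule add_mono)
          show "g * s \<le> g * max s 0" using g by (intro mult_left_mono) auto
          have "g * g \<le> g * (1/4)" using g by (intro mult_left_mono) auto
          then show "g\<^sup>2 / 2 \<le> g * (1/8)" by (simp add: power2_eq_square)
        qed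
        finally have "1 - ?r s \<le> g * (max s 0 + 1/8)" by (simp add: algebra_simps)
        then show ?thesis using True by (simp add: ennreal_leI)
      qed simp
      finally show ?thesis .
    qed
    also have "ennreal (A + B * \<bar>s\<bar>) * ennreal (g * (max s 0 + 1/8)) = ennreal (g * (max s 0 + 1/8) * (A + B * \<bar>s\<bar>))"
      using c g by (simp add: ennreal_mult'' mult.commute)
    finally show "(\<integral>\<^sup>+u. ennreal (if u \<le> ?r (e \<bullet> \<xi>) then 0 else A + B * \<bar>e \<bullet> \<xi>\<bar>) \<partial>?U)
        \<le> ennreal (g * (max (e \<bullet> \<xi>) 0 + 1/8) * (A + B * \<bar>e \<bullet> \<xi>\<bar>))"
      unfolding s_def by (simp add: mult_left_mono)
  qed
  also have "\<dots> = (\<integral>\<^sup>+s. ennreal (std_normal_density s) * ennreal (g * (max s 0 + 1/8) * (A + B * \<bar>s\<bar>)) \<partial>lborel)"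
    by (rule distributed_nn_integral[OF distributed_std_gauss_inner[OF e], symmetric]) simp
  also have "\<dots> \<le> (\<integral>\<^sup>+s. ennreal (g * (A/8 * (std_normal_density s * s ^ (2 * 0)) + A/2 * (std_normal_density s * s ^ (2 * 0 + 1))
      + (A/2 + B/8) * (std_normal_density s * \<bar>s\<bar> ^ (2 * 0 + 1)) + B * (std_normal_density s * s ^ (2 * 1)))) \<partial>lborel)"
  proof (rule nn_integral_mono)
    fix s :: real
    \<comment> \<open>Writing max s 0 as (s + |s|) / 2 leaves moments of order at most 2. The
      product of max s 0 with B |s| vanishes for negative \<open>s\<close> and is enlarged to B
      s^2.\<close>
    have "(max s 0 + 1/8) * (A + B * \<bar>s\<bar>) \<le> A/8 + A/2 * s + (A/2 + B/8) * \<bar>s\<bar> + B * s\<^sup>2"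
      using AB by (cases "s \<ge> 0") (auto simp: algebra_simps power2_eq_square max_def diff_divide_distrib)
    hence "std_normal_density s * (g * ((max s 0 + 1/8) * (A + B * \<bar>s\<bar>)))
        \<le> std_normal_density s * (g * (A/8 + A/2 * s + (A/2 + B/8) * \<bar>s\<bar> + B * s\<^sup>2))"
      using g by (intro mult_left_mono) auto
    then show "ennreal (std_normal_density s) * ennreal (g * (max s 0 + 1/8) * (A + B * \<bar>s\<bar>)) \<le>
      ennreal (g * (A/8 * (std_normal_density s * s ^ (2 * 0)) + A/2 * (std_normal_density s * s ^ (2 * 0 + 1))
      + (A/2 + B/8) * (std_normal_density s * \<bar>s\<bar> ^ (2 * 0 + 1)) + B * (std_normal_density s * s ^ (2 * 1))))"
      using g by (subst ennreal_mult'[symmetric]) (auto intro!: ennreal_leI simp: algebra_simps power2_eq_square)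
  qed
  also have "\<dots> \<le> ennreal (g * (21/40 * A + 11/10 * B))"
  proof -
    let ?f = "\<lambda>s. g * (A/8 * (std_normal_density s * s ^ (2 * 0)) + A/2 * (std_normal_density s * s ^ (2 * 0 + 1))
      + (A/2 + B/8) * (std_normal_density s * \<bar>s\<bar> ^ (2 * 0 + 1)) + B * (std_normal_density s * s ^ (2 * 1)))"
    let ?v = "g * (A/8 * (fact (2 * 0) / (2^0 * fact 0)) + A/2 * 0 + (A/2 + B/8) * (sqrt (2/pi) * 2^0 * fact 0)
        + B * (fact (2 * 1) / (2^1 * fact 1)))"
    have hb: "has_bochner_integral lborel ?f ?v"
      by (intro has_bochner_integral_mult_right has_bochner_integral_add
          std_normal_moment_even std_normal_moment_odd std_normal_moment_abs_odd)
    have nn: "?f s \<ge> 0" for s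
    proof -
      have "A/2 * (s + \<bar>s\<bar>) \<ge> 0" using AB by (intro mult_nonneg_nonneg) linarith+
      moreover have "B/8 * \<bar>s\<bar> \<ge> 0" "B * s\<^sup>2 \<ge> 0" using AB by auto
      ultimately have "A/8 + A/2 * (s + \<bar>s\<bar>) + B/8 * \<bar>s\<bar> + B * s\<^sup>2 \<ge> 0"
        using AB by linarith
      hence "g * (std_normal_density s * (A/8 + A/2 * (s + \<bar>s\<bar>) + B/8 * \<bar>s\<bar> + B * s\<^sup>2)) \<ge> 0"
        using g by simp
      then show ?thesis by (simp add: algebra_simps power2_eq_square add_divide_distrib)
    qed
    have "(\<integral>\<^sup>+s. ennreal (?f s) \<partial>lborel) = ennreal (integral\<^sup>L lborel ?f)"
      using hb nn by (intro nn_integral_eq_integral AE_I2) (blast dest: integrable.intros)+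
    also have "integral\<^sup>L lborel ?f = ?v" using hb by (rule has_bochner_integral_integral_eq)
    also have "ennreal ?v \<le> ennreal (g * (21/40 * A + 11/10 * B))"
    proof (intro ennreal_leI mult_left_mono g)
      \<comment> \<open>The first absolute moment is sqrt (2/pi), so the coefficients become 1/8 +
        2/5 = 21/40 and 1 + 1/10 = 11/10.\<close>
      have "sqrt (2/pi) \<le> 4/5"
        using pi_approx by (intro real_le_lsqrt) (auto simp: field_simps power2_eq_square)
      hence "(A/2 + B/8) * sqrt (2/pi) \<le> (A/2 + B/8) * (4/5)" using AB by (intro mult_left_mono) auto
      then show "A/8 * (fact (2 * 0) / (2^0 * fact 0)) + A/2 * 0 + (A/2 + B/8) * (sqrt (2/pi) * 2^0 * fact 0)
        + B * (fact (2 * 1) / (2^1 * fact 1)) \<le> 21/40 * A + 11/10 * B" by simp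
    qed
    finally show ?thesis .
  qed
  finally show ?thesis .
qed

section \<open>The coupling\<close>

abbreviation particle_noise :: "('a::euclidean_space \<times> real) measure" where
  "particle_noise \<equiv> std_gauss \<Otimes>\<^sub>M uniform_measure lborel {0..1}"

lemma prob_space_particle_noise: "prob_space (particle_noise :: ('a::euclidean_space \<times> real) measure)"
proof -
  interpret G: prob_space "std_gauss :: 'a measure" by (rule prob_space_std_gauss)
  interpret U: prob_space "uniform_measure lborel {0..1::real}" by (rule prob_space_uniform_measure) auto
  interpret GU: pair_prob_space "std_gauss :: 'a measure" "uniform_measure lborel {0..1::real}" ..
  show ?thesis by (rule GU.prob_space_axioms)
qed

text \<open>The integrand \<open>F\<close> need not be measurable: \<open>\<integral>\<^sup>+\<close> is monotone on arbitrary functions, and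
  only the bounds \<open>h i\<close> of a single coordinate are integrated.\<close>

lemma nn_integral_noise_sum_bound:
  fixes F :: "('n::finite \<Rightarrow> 'a::euclidean_space \<times> real) \<Rightarrow> real" and c b :: "'n \<Rightarrow> real" and k :: real
  assumes F0: "\<And>\<omega>. 0 \<le> F \<omega>" and F: "\<And>\<omega>. F \<omega> \<le> k * (\<Sum>i\<in>UNIV. c i + h i (\<omega> i))" and k: "k \<ge> 0"
    and h0: "\<And>i y. 0 \<le> h i y" and hm: "\<And>i. h i \<in> borel_measurable particle_noise"
    and hb: "\<And>i. (\<integral>\<^sup>+y. ennreal (h i y) \<partial>particle_noise) \<le> ennreal (b i)" and b0: "\<And>i. 0 \<le> b i"
  shows "(\<integral>\<^sup>+\<omega>. ennreal (F \<omega>) \<partial>noise) \<le> ennreal (k * (\<Sum>i\<in>UNIV. c i + b i))"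
proof -
  interpret N: prob_space "noise :: ('n \<Rightarrow> 'a \<times> real) measure"
    unfolding noise_def by (intro prob_space_PiM prob_space_particle_noise)
  \<comment> \<open>\<open>C\<close> may be negative, because the \<open>c i\<close> will contain
    the drift, and \<open>ennreal\<close> would truncate it. Hence |C| is added before the integral
    is split and subtracted at the end.\<close>
  define C where "C = k * (\<Sum>i\<in>UNIV. c i)"
  have hi: "(\<lambda>\<omega>. h i (\<omega> i)) \<in> borel_measurable noise" for i
    unfolding noise_def using hm by (intro measurable_PiM_component_rev) auto
  have "(\<integral>\<^sup>+\<omega>. ennreal (F \<omega>) \<partial>noise) + ennreal \<bar>C\<bar>
      \<le> (\<integral>\<^sup>+\<omega>. ennreal (C + k * (\<Sum>i\<in>UNIV. h i (\<omega> i))) \<partial>noise) + (\<integral>\<^sup>+\<omega>. ennreal \<bar>C\<bar> \<partial>(noise :: ('n \<Rightarrow> 'a \<times> real) measure))"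
  proof (rule add_mono)
    show "(\<integral>\<^sup>+\<omega>. ennreal (F \<omega>) \<partial>noise) \<le> (\<integral>\<^sup>+\<omega>. ennreal (C + k * (\<Sum>i\<in>UNIV. h i (\<omega> i))) \<partial>noise)"
      using F by (intro nn_integral_mono ennreal_leI) (simp add: C_def sum.distrib distrib_left)
  qed (simp add: N.emeasure_space_1)
  also have "\<dots> = (\<integral>\<^sup>+\<omega>. ennreal (C + k * (\<Sum>i\<in>UNIV. h i (\<omega> i))) + ennreal \<bar>C\<bar> \<partial>noise)"
    using hi by (intro nn_integral_add[symmetric]) auto
  also have "\<dots> = (\<integral>\<^sup>+\<omega>. ennreal (C + \<bar>C\<bar>) + ennreal k * (\<Sum>i\<in>UNIV. ennreal (h i (\<omega> i))) \<partial>noise)"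
  proof (rule nn_integral_cong)
    fix \<omega> :: "'n \<Rightarrow> 'a \<times> real"
    have "0 \<le> C + k * (\<Sum>i\<in>UNIV. h i (\<omega> i))"
      using order_trans[OF F0 F, of \<omega>] by (simp add: C_def sum.distrib distrib_left)
    hence "ennreal (C + k * (\<Sum>i\<in>UNIV. h i (\<omega> i))) + ennreal \<bar>C\<bar> = ennreal ((C + \<bar>C\<bar>) + k * (\<Sum>i\<in>UNIV. h i (\<omega> i)))"
      by (simp flip: ennreal_plus add: algebra_simps)
    also have "\<dots> = ennreal (C + \<bar>C\<bar>) + ennreal k * (\<Sum>i\<in>UNIV. ennreal (h i (\<omega> i)))"
      using k h0 by (subst ennreal_plus) (auto intro!: mult_nonneg_nonneg sum_nonneg simp: ennreal_mult sum_nonneg)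
    finally show "ennreal (C + k * (\<Sum>i\<in>UNIV. h i (\<omega> i))) + ennreal \<bar>C\<bar>
        = ennreal (C + \<bar>C\<bar>) + ennreal k * (\<Sum>i\<in>UNIV. ennreal (h i (\<omega> i)))" .
  qed
  also have "\<dots> = ennreal (C + \<bar>C\<bar>) + ennreal k * (\<Sum>i\<in>UNIV. \<integral>\<^sup>+\<omega>. ennreal (h i (\<omega> i)) \<partial>noise)"
    using hi by (simp add: nn_integral_add nn_integral_cmult nn_integral_sum N.emeasure_space_1)
  also have "\<dots> \<le> ennreal (C + \<bar>C\<bar>) + ennreal k * (\<Sum>i\<in>UNIV. ennreal (b i))"
  proof (intro add_left_mono mult_left_mono sum_mono)
    fix i :: 'n
    have "(\<integral>\<^sup>+\<omega>. ennreal (h i (\<omega> i)) \<partial>noise)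
       = (\<integral>\<^sup>+y. ennreal (h i y) \<partial>distr noise particle_noise (\<lambda>\<omega>. \<omega> i))"
      using hm[of i] by (subst nn_integral_distr) (auto simp: noise_def)
    also have "distr noise particle_noise (\<lambda>\<omega>. \<omega> i) = (particle_noise :: ('a \<times> real) measure)"
      unfolding noise_def by (intro distr_PiM_component prob_space_particle_noise) auto
    finally show "(\<integral>\<^sup>+\<omega>. ennreal (h i (\<omega> i)) \<partial>noise) \<le> ennreal (b i)" using hb[of i] by simp
  qed auto
  also have "\<dots> = ennreal (C + \<bar>C\<bar> + k * (\<Sum>i\<in>UNIV. b i))"
    using b0 k by (subst ennreal_plus) (auto intro!: mult_nonneg_nonneg sum_nonneg simp: ennreal_mult sum_nonneg)
  finally have "(\<integral>\<^sup>+\<omega>. ennreal (F \<omega>) \<partial>noise) + ennreal \<bar>C\<bar> \<le> ennreal (C + \<bar>C\<bar> + k * (\<Sum>i\<in>UNIV. b i))" .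
  hence "(\<integral>\<^sup>+\<omega>. ennreal (F \<omega>) \<partial>noise) + ennreal \<bar>C\<bar> - ennreal \<bar>C\<bar>
      \<le> ennreal (C + \<bar>C\<bar> + k * (\<Sum>i\<in>UNIV. b i)) - ennreal \<bar>C\<bar>"
    by (rule ennreal_minus_mono) simp
  also have "\<dots> = ennreal (k * (\<Sum>i\<in>UNIV. c i + b i))"
    by (simp add: ennreal_minus C_def sum.distrib distrib_left)
  finally show ?thesis by simp
qed

lemma norm_e_dir: "norm (e_dir z) = 1"
  by (auto simp: e_dir_def some_in_eq)

lemma norm_scaleR_e_dir: "norm z *\<^sub>R e_dir z = z"
  by (simp add: e_dir_def)

text \<open>Cauchy-Schwarz bounds the inner product by r a, where \<open>a\<close> is the gradient
  difference at distance \<open>r\<close>; completing the square absorbs a^2 / L at the cost L r^2 /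
  4, which must therefore be at least K r^2. A unit vector exists, so distances beyond
  \<open>R\<close> occur.\<close>

lemma cocoercive_constants:
  fixes gV :: "'a::euclidean_space \<Rightarrow> 'a"
  assumes "L > 0" "R \<ge> 0"
    and conv: "\<And>y w. norm (y - w) \<ge> R \<Longrightarrow>
           inner (y - w) (gV y - gV w) \<ge> K * (norm (y - w))\<^sup>2 + (norm (gV y - gV w))\<^sup>2 / L"
  shows "4 * K \<le> L"
proof -
  obtain b :: 'a where b: "norm b = 1" using norm_e_dir by blast
  define r where "r = norm ((R + 1) *\<^sub>R b - 0)"
  define a where "a = norm (gV ((R + 1) *\<^sub>R b) - gV 0)"
  have r: "r > 0" "r \<ge> R" using \<open>R \<ge> 0\<close> b by (auto simp: r_def)
  have "K * r\<^sup>2 + a\<^sup>2 / L \<le> r * a"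
    using conv[of "(R + 1) *\<^sub>R b" 0] r(2) norm_cauchy_schwarz[of "(R + 1) *\<^sub>R b - 0" "gV ((R + 1) *\<^sub>R b) - gV 0"]
    unfolding r_def a_def by linarith
  moreover have "r * a \<le> L * r\<^sup>2 / 4 + a\<^sup>2 / L"
  proof -
    have "0 \<le> (L * r / 2 - a)\<^sup>2 / L" using \<open>L > 0\<close> by simp
    also have "\<dots> = L * r\<^sup>2 / 4 + a\<^sup>2 / L - r * a"
      using \<open>L > 0\<close> by (simp add: field_simps power2_eq_square)
    finally show ?thesis by simp
  qed
  ultimately have "K * r\<^sup>2 \<le> L / 4 * r\<^sup>2" by simp
  then show ?thesis using r by simp
qed

text \<open>Only the gradients appear; the potentials return when \<open>gradU\<close> is identified
  with \<open>grad\<close>. The split on \<open>Rtil L K R = 0\<close> encodes 1/0 as infinity,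
  since division by zero is zero in HOL.\<close>

locale xhmc_coupling =
  fixes gV :: "'a::euclidean_space \<Rightarrow> 'a" and gW :: "'a \<Rightarrow> 'a \<Rightarrow> 'a" and L K R Lt T eps :: real
  assumes L: "L > 0" and K: "K > 0" and R: "R \<ge> 0" and Lt: "Lt \<ge> 0"
    and gV_lip: "\<And>y w. norm (gV y - gV w) \<le> L * norm (y - w)"
    and gV_conv: "\<And>y w. norm (y - w) \<ge> R \<Longrightarrow>
           inner (y - w) (gV y - gV w) \<ge> K * (norm (y - w))\<^sup>2 + (norm (gV y - gV w))\<^sup>2 / L"
    and gW_lip: "\<And>y w y' w'. norm (gW y w - gW y' w') \<le> Lt * (norm (y - y') + norm (w - w'))"
    and T: "T > 0" and eps: "eps \<ge> 0"
    and LT2: "L * T\<^sup>2 \<le> 3 / 5 * (if Rtil L K R = 0 then 1 / 4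
                              else min (1 / 4) (3 / (1280 * L * (Rtil L K R)\<^sup>2)))"
    and epsLt: "eps * Lt \<le> 5 / 64 * (K / sqrt (7 / 6 + 3 / (2 * K * T\<^sup>2)))
                      * exp (- 5 * Rtil L K R / (2 * T) - 5)"
begin

definition grad :: "('n::finite \<Rightarrow> 'a) \<Rightarrow> 'n \<Rightarrow> 'a" where
  "grad x i = gV (x i) + (eps / real CARD('n)) *\<^sub>R (\<Sum>j\<in>UNIV. gW (x i) (x j))"

abbreviation "Rt \<equiv> Rtil L K R"
abbreviation "f \<equiv> fconc L K R T"
abbreviation "\<gamma> \<equiv> gam L K R T"
text \<open>The smallest slope of \<open>f\<close>, attained from \<open>R1\<close> on.\<close>

definition "\<theta> = exp (- R1 L K R T / T)"

section \<open>Consequences of the smallness hypotheses\<close>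

lemma K_le: "4 * K \<le> L"
  using cocoercive_constants[OF L R gV_conv] .

text \<open>By 4 K <= L the radicand is at least 3/2 > 36/25. The factor 6/5 is the slack that
  \<open>synchronous_contraction\<close> asks for.\<close>

lemma Rt_ge: "6 / 5 * R \<le> Rt"
proof -
  have "(6/5)\<^sup>2 \<le> (2 * L + K) / (6 * K)" using K_le K by (simp add: field_simps power2_eq_square)
  hence "6/5 \<le> sqrt ((2 * L + K) / (6 * K))" by (rule real_le_rsqrt)
  then show ?thesis unfolding Rtil_def using R by (rule mult_right_mono)
qed

lemma Rt_nonneg: "Rt \<ge> 0"
  using Rt_ge R by linarith

lemma R1_nonneg: "R1 L K R T \<ge> 0"
  using Rt_nonneg T by (simp add: R1_def)

lemma LT: "L * T\<^sup>2 \<le> 3 / 20"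
  using LT2 by (auto split: if_splits simp: min_le_iff_disj min_def)

lemma KT: "K * T\<^sup>2 \<le> 3 / 80"
  using mult_right_mono[OF K_le, of "T\<^sup>2"] LT by simp

lemma theta_eq: "\<theta> = exp (- 5 * Rt / (4 * T)) * exp (- 5 / 2)"
  unfolding \<theta>_def R1_def exp_add[symmetric] using T by (simp add: field_simps)

lemma theta_pos: "\<theta> > 0"
  by (simp add: \<theta>_def)

lemma exp_minus_five_halves: "exp (- 5 / 2 :: real) \<le> 1 / 12" "1 / 13 \<le> exp (- 5 / 2 :: real)"
proof -
  have eq: "exp (- 5 / 2 :: real) = 1 / exp (5/2)" by (simp add: exp_minus inverse_eq_divide)
  show "exp (- 5 / 2 :: real) \<le> 1 / 12" unfolding eq
    by (rule frac_le) (simp_all add: exp_five_halves)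
  show "1 / 13 \<le> exp (- 5 / 2 :: real)" unfolding eq
    by (rule frac_le) (simp_all add: exp_five_halves)
qed

text \<open>exp (- 5 \<open>Rt\<close> / (4 T)) is already below the slope at \<open>r\<close>, and
  exp (- 5/2) adds the factor 1/12. Overshooting beyond \<open>R1\<close> is thus cheap relative to
  the slope at the start.\<close>

lemma theta_le_slope:
  assumes "0 \<le> r" "r \<le> Rt"
  shows "\<theta> \<le> exp (- r / T) / 12"
proof -
  have "exp (- 5 * Rt / (4 * T)) \<le> exp (- r / T)"
    using assms T by (simp add: field_simps)
  hence "exp (- 5 * Rt / (4 * T)) * exp (- 5 / 2) \<le> exp (- r / T) * (1 / 12)"
    by (intro mult_mono exp_minus_five_halves) auto
  then show ?thesis by (simp add: theta_eq)
qed

lemma theta_le: "\<theta> \<le> 1 / 12"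
  using theta_le_slope[of 0] Rt_nonneg by simp

text \<open>The exponential in the hypothesis on eps is exactly the square of
  \<open>\<theta>\<close>, and the square root in its denominator is at least 1.\<close>

lemma interaction_strength: "eps * Lt * T\<^sup>2 \<le> 5 / 64 * (K * T\<^sup>2) * \<theta>\<^sup>2"
proof -
  have th: "exp (- 5 * Rt / (2 * T) - 5) = \<theta>\<^sup>2"
    unfolding theta_eq power2_eq_square exp_add[symmetric] by (simp add: field_simps)
  have "3 / (2 * K * T\<^sup>2) \<ge> 0" using K by simp
  hence "1 \<le> 7 / 6 + 3 / (2 * K * T\<^sup>2)" by linarith
  hence "1 \<le> sqrt (7 / 6 + 3 / (2 * K * T\<^sup>2))" by (simp only: real_sqrt_ge_1_iff)
  hence "K / sqrt (7 / 6 + 3 / (2 * K * T\<^sup>2)) \<le> K / 1"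
    using K by (intro frac_le) simp_all
  hence "5 / 64 * (K / sqrt (7 / 6 + 3 / (2 * K * T\<^sup>2))) * \<theta>\<^sup>2 \<le> 5 / 64 * (K / 1) * \<theta>\<^sup>2"
    by (intro mult_right_mono mult_left_mono) simp_all
  with epsLt have "eps * Lt \<le> 5 / 64 * (K / 1) * \<theta>\<^sup>2" unfolding th by (rule order_trans)
  from mult_right_mono[OF this, of "T\<^sup>2"] show ?thesis by (simp add: algebra_simps)
qed

lemma interaction_nonneg: "eps * Lt * T\<^sup>2 \<ge> 0"
  using eps Lt by simp

lemma interaction_small: "eps * Lt * T\<^sup>2 \<le> 1 / 1000"
proof -
  have "(K * T\<^sup>2) * \<theta>\<^sup>2 \<le> 3/80 * (1/12)\<^sup>2"
    using KT theta_le theta_pos K by (intro mult_mono power_mono) auto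
  then show ?thesis using interaction_strength by (simp add: power2_eq_square)
qed

text \<open>Since 156 = 12 * 13, exp (- 5/2) >= 1/13 converts the stated rate into one in terms of
  \<open>\<theta>\<close>.\<close>

lemma contraction_rate_le: "K * T\<^sup>2 / 156 * exp (- 5 * Rt / (4 * T)) \<le> K * T\<^sup>2 * \<theta> / 12"
proof -
  have "K * T\<^sup>2 / 12 * exp (- 5 * Rt / (4 * T)) * (1/13) \<le> K * T\<^sup>2 / 12 * exp (- 5 * Rt / (4 * T)) * exp (- 5 / 2)"
    using K exp_minus_five_halves by (intro mult_left_mono) auto
  then show ?thesis by (simp add: theta_eq)
qed

text \<open>The last bound makes the deviation from free motion a fraction of the contraction:
  (11/20) (3/20) \<gamma> T < \<gamma> T / 10. The constant 3/1280 in the hypothesis amounts to L T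
  \<open>Rt\<close> <= 3/80.\<close>

lemma gamma_bounds:
  assumes "Rt > 0"
  shows "\<gamma> > 0" "\<gamma> * T \<le> 1" "\<gamma> * Rt \<le> 1 / 4" "L * T\<^sup>2 \<le> 3 / 20 * (\<gamma> * T)"
proof -
  have g: "\<gamma> = min (1 / T) (1 / (4 * Rt))" using assms by (simp add: gam_def)
  show "\<gamma> > 0" using g T assms by simp
  have "\<gamma> \<le> 1 / T" "\<gamma> \<le> 1 / (4 * Rt)" using g by auto
  then show "\<gamma> * T \<le> 1" "\<gamma> * Rt \<le> 1 / 4" using T assms by (auto simp: field_simps)
  have "L * T\<^sup>2 \<le> 9 / (6400 * L * Rt\<^sup>2)" using LT2 assms by (simp split: if_splits)
  hence "L * T\<^sup>2 * (L * Rt\<^sup>2) \<le> 9 / (6400 * L * Rt\<^sup>2) * (L * Rt\<^sup>2)"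
    using L by (intro mult_right_mono) auto
  hence "(L * T * Rt)\<^sup>2 \<le> (3 / 80)\<^sup>2" using L assms by (simp add: power2_eq_square field_simps)
  hence "L * T * Rt \<le> 3 / 80" by (rule power2_le_imp_le) simp
  hence "L * T\<^sup>2 \<le> 3 / 20 * (T / (4 * Rt))"
    using mult_right_mono[of "L * T * Rt" "3/80" T] T assms by (simp add: field_simps power2_eq_square)
  then show "L * T\<^sup>2 \<le> 3 / 20 * (\<gamma> * T)" using LT T by (simp add: g min_def)
qed

section \<open>From gradients to coupled trajectories\<close>

lemma grad_lipschitz:
  fixes x y :: "'n::finite \<Rightarrow> 'a"
  shows "norm (grad x i - grad y i) \<le> (L + 2 * (eps * Lt)) * (\<Sum>j\<in>UNIV. norm (x j - y j))"
proof -
  let ?S = "\<Sum>j\<in>UNIV. norm (x j - y j)"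
  have i: "norm (x i - y i) \<le> ?S" by (rule member_le_sum) auto
  have "norm ((\<Sum>j\<in>UNIV. gW (x i) (x j)) - (\<Sum>j\<in>UNIV. gW (y i) (y j))) \<le> (\<Sum>j\<in>(UNIV::'n set). Lt * (2 * ?S))"
    unfolding sum_subtractf[symmetric]
  proof (rule sum_norm_le)
    fix j
    have "norm (x j - y j) \<le> ?S" by (rule member_le_sum) auto
    hence "Lt * (norm (x i - y i) + norm (x j - y j)) \<le> Lt * (2 * ?S)"
      using i Lt by (intro mult_left_mono) auto
    then show "norm (gW (x i) (x j) - gW (y i) (y j)) \<le> Lt * (2 * ?S)"
      using gW_lip order_trans by blast
  qed
  hence "(eps / real CARD('n)) * norm ((\<Sum>j\<in>UNIV. gW (x i) (x j)) - (\<Sum>j\<in>UNIV. gW (y i) (y j)))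
      \<le> (eps / real CARD('n)) * (real CARD('n) * (Lt * (2 * ?S)))"
    using eps by (intro mult_left_mono) auto
  hence 1: "norm ((eps / real CARD('n)) *\<^sub>R ((\<Sum>j\<in>UNIV. gW (x i) (x j)) - (\<Sum>j\<in>UNIV. gW (y i) (y j)))) \<le> 2 * (eps * Lt) * ?S"
    using eps by simp
  have "L * norm (x i - y i) \<le> L * ?S" using i L by simp
  hence 2: "norm (gV (x i) - gV (y i)) \<le> L * ?S" using gV_lip order_trans by blast
  have eq: "grad x i - grad y i = (gV (x i) - gV (y i))
      + (eps / real CARD('n)) *\<^sub>R ((\<Sum>j\<in>UNIV. gW (x i) (x j)) - (\<Sum>j\<in>UNIV. gW (y i) (y j)))"
    by (simp add: grad_def scaleR_diff_right)
  have "norm (grad x i - grad y i) \<le> L * ?S + 2 * (eps * Lt) * ?S"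
    unfolding eq by (rule norm_triangle_mono[OF 2 1])
  then show ?thesis by (simp add: algebra_simps)
qed

lemma coupled_flows:
  fixes x x' v v' :: "'n::finite \<Rightarrow> 'a"
  assumes fl: "is_ham_flow grad x v q p" and fl': "is_ham_flow grad x' v' q' p'"
    and free: "\<And>i t. 0 \<le> t \<Longrightarrow> t \<le> T \<Longrightarrow> norm ((x i - x' i) + t *\<^sub>R (v i - v' i)) \<le> M i"
  shows "coupled_trajectories (\<lambda>i t. q i t - q' i t) (\<lambda>i t. p i t - p' i t)
     (\<lambda>i t. gV (q i t) - gV (q' i t))
     (\<lambda>i t. (eps / real CARD('n)) *\<^sub>R (\<Sum>j\<in>UNIV. gW (q i t) (q j t) - gW (q' i t) (q' j t)))
     M L (eps * Lt) T"
proof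
  note d = fl[unfolded is_ham_flow_def] fl'[unfolded is_ham_flow_def]
  fix i :: 'n and t :: real
  let ?J = "(eps / real CARD('n)) *\<^sub>R (\<Sum>j\<in>UNIV. gW (q i t) (q j t) - gW (q' i t) (q' j t))"
  show "((\<lambda>t. q i t - q' i t) has_vector_derivative p i t - p' i t) (at t)"
    using d by (intro derivative_intros) auto
  have "((\<lambda>t. p i t - p' i t) has_vector_derivative - grad (\<lambda>j. q j t) i - - grad (\<lambda>j. q' j t) i) (at t)"
    using d by (intro derivative_intros) auto
  then show "((\<lambda>t. p i t - p' i t) has_vector_derivative - (gV (q i t) - gV (q' i t) + ?J)) (at t)"
    by (simp add: grad_def sum_subtractf scaleR_diff_right algebra_simps)
  show "norm (gV (q i t) - gV (q' i t)) \<le> L * norm (q i t - q' i t)" by (rule gV_lip)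
  have "norm (\<Sum>j\<in>UNIV. gW (q i t) (q j t) - gW (q' i t) (q' j t))
      \<le> (\<Sum>j\<in>UNIV. Lt * (norm (q i t - q' i t) + norm (q j t - q' j t)))"
    by (intro sum_norm_le gW_lip)
  also have "\<dots> = real CARD('n) * (Lt * (norm (q i t - q' i t) + (\<Sum>j\<in>UNIV. norm (q j t - q' j t)) / real CARD('n)))"
    by (simp add: sum.distrib sum_distrib_left[symmetric] algebra_simps)
  finally have "(eps / real CARD('n)) * norm (\<Sum>j\<in>UNIV. gW (q i t) (q j t) - gW (q' i t) (q' j t))
     \<le> (eps / real CARD('n)) * (real CARD('n) * (Lt * (norm (q i t - q' i t) + (\<Sum>j\<in>UNIV. norm (q j t - q' j t)) / real CARD('n))))"
    using eps by (intro mult_left_mono) auto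
  then show "norm ?J \<le> eps * Lt * (norm (q i t - q' i t) + (\<Sum>j\<in>UNIV. norm (q j t - q' j t)) / real CARD('n))"
    using eps by (simp add: mult.assoc)
  show "norm (q i 0 - q' i 0 + t *\<^sub>R (p i 0 - p' i 0)) \<le> M i" if "0 \<le> t" "t \<le> T"
    using free[OF that, of i] d by simp
qed (use T L eps Lt LT interaction_small in auto)


section \<open>One step of a single particle\<close>

definition reflects :: "'a \<Rightarrow> 'a \<times> real \<Rightarrow> bool" where
  "reflects z y \<longleftrightarrow> norm z < Rt \<and>
     \<not> snd y \<le> std_normal_density (e_dir z \<bullet> fst y + \<gamma> * norm z) / std_normal_density (e_dir z \<bullet> fst y)"

definition free_bound :: "'a \<Rightarrow> 'a \<times> real \<Rightarrow> real" where
  "free_bound z y = norm z + (if reflects z y then 2 * T * \<bar>e_dir z \<bullet> fst y\<bar> else 0)"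

lemma eta_coup_diff:
  "fst (\<omega> i) - eta_coup L K R T x x' \<omega> i =
    (if norm (x i - x' i) \<ge> Rt then 0
     else if reflects (x i - x' i) (\<omega> i) then (2 * (e_dir (x i - x' i) \<bullet> fst (\<omega> i))) *\<^sub>R e_dir (x i - x' i)
     else - \<gamma> *\<^sub>R (x i - x' i))"
  by (simp add: eta_coup_def Let_def reflects_def)

text \<open>Translation multiplies \<open>z\<close> by 1 - t \<gamma>, which lies between 0 and 1 as
  \<gamma> T <= 1; reflection adds a vector of length 2 t |s|; synchronous motion leaves
  \<open>z\<close> fixed.\<close>

lemma norm_free_le:
  assumes t: "0 \<le> t" "t \<le> T"
  shows "norm ((x i - x' i) + t *\<^sub>R (fst (\<omega> i) - eta_coup L K R T x x' \<omega> i)) \<le> free_bound (x i - x' i) (\<omega> i)"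
proof -
  define z where "z = x i - x' i"
  define s where "s = e_dir z \<bullet> fst (\<omega> i)"
  consider "norm z \<ge> Rt" | "norm z < Rt" "reflects z (\<omega> i)" | "norm z < Rt" "\<not> reflects z (\<omega> i)" by linarith
  then show ?thesis
  proof cases
    case 1
    then show ?thesis by (simp add: eta_coup_diff z_def free_bound_def reflects_def)
  next
    case 2
    have "norm (z + t *\<^sub>R ((2 * s) *\<^sub>R e_dir z)) \<le> norm z + norm (t *\<^sub>R ((2 * s) *\<^sub>R e_dir z))"
      by (rule norm_triangle_ineq)
    also have "norm (t *\<^sub>R ((2 * s) *\<^sub>R e_dir z)) = 2 * t * \<bar>s\<bar>"
      using t by (simp add: norm_e_dir abs_mult)
    also have "\<dots> \<le> 2 * T * \<bar>s\<bar>" using t by (intro mult_right_mono) auto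
    finally show ?thesis using 2 by (simp add: eta_coup_diff z_def[symmetric] free_bound_def s_def)
  next
    case 3
    have "Rt > 0" using 3 norm_ge_zero[of z] by linarith
    note g = gamma_bounds[OF this]
    have "t * \<gamma> \<le> T * \<gamma>" using t g by (intro mult_right_mono) auto
    also have "T * \<gamma> \<le> 1" using g(2) by (simp only: mult.commute)
    finally have tg: "0 \<le> t * \<gamma>" "t * \<gamma> \<le> 1" using t g(1) by simp_all
    have "z + t *\<^sub>R (- \<gamma> *\<^sub>R z) = (1 - t * \<gamma>) *\<^sub>R z" by (simp add: algebra_simps)
    hence "norm (z + t *\<^sub>R (- \<gamma> *\<^sub>R z)) = (1 - t * \<gamma>) * norm z" using tg by simp
    also have "\<dots> \<le> 1 * norm z" using tg by (intro mult_right_mono) auto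
    finally show ?thesis using 3 by (simp add: eta_coup_diff z_def[symmetric] free_bound_def)
  qed
qed

text \<open>Guaranteed change of \<open>f\<close> without reflection or interaction: loss of
  distance times slope, where the far case uses only the smallest slope \<open>\<theta>\<close>. The
  sum over particles charges it in every case, and \<open>reflection_cost\<close> refunds
  it.\<close>

definition drift :: "'a \<Rightarrow> real" where
  "drift z = (if norm z \<ge> Rt then - (K * T\<^sup>2 / 3 * \<theta> * norm z)
     else - (9 / 10 * (\<gamma> * T) * norm z * exp (- norm z / T)))"

text \<open>On reflection the increase of \<open>f\<close> is at most \<open>T f'(r)\<close> plus a tail term beyond \<open>R1\<close>, where
  \<open>f\<close> has slope \<open>\<theta>\<close>.\<close>

lemma fconc_step:
  fixes x x' :: "'n::finite \<Rightarrow> 'a"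
  assumes fl: "is_ham_flow grad x (\<lambda>i. fst (\<omega> i)) q p"
    and fl': "is_ham_flow grad x' (eta_coup L K R T x x' \<omega>) q' p'"
  defines "M \<equiv> \<lambda>i. free_bound (x i - x' i) (\<omega> i)"
  shows "f (norm (q i T - q' i T)) \<le> f (norm (x i - x' i)) +
      (if reflects (x i - x' i) (\<omega> i)
       then T * exp (- norm (x i - x' i) / T) * (1 + 11 / 60 * \<bar>e_dir (x i - x' i) \<bullet> fst (\<omega> i)\<bar>)
       else drift (x i - x' i))
      + 4 * (eps * Lt * T\<^sup>2 * (M i + (\<Sum>j\<in>UNIV. M j) / real CARD('n)))"
proof -
  interpret coupled_trajectories "\<lambda>i t. q i t - q' i t" "\<lambda>i t. p i t - p' i t"
     "\<lambda>i t. gV (q i t) - gV (q' i t)"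
     "\<lambda>i t. (eps / real CARD('n)) *\<^sub>R (\<Sum>j\<in>UNIV. gW (q i t) (q j t) - gW (q' i t) (q' j t))"
     M L "eps * Lt" T
    unfolding M_def by (rule coupled_flows[OF fl fl' norm_free_le])
  define z where "z = x i - x' i"
  define r where "r = norm z"
  define y where "y = norm (q i T - q' i T)"
  define s where "s = e_dir z \<bullet> fst (\<omega> i)"
  have q0: "q i 0 = x i" "q' i 0 = x' i" "p i 0 - p' i 0 = fst (\<omega> i) - eta_coup L K R T x x' \<omega> i"
    using fl fl' by (auto simp: is_ham_flow_def)
  have r0: "r \<ge> 0" "y \<ge> 0" by (auto simp: r_def y_def)
  have Qe: "Q i = eps * Lt * T\<^sup>2 * (M i + (\<Sum>j\<in>UNIV. M j) / real CARD('n))"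
    by (simp add: Q_def avgM_def)
  have slope: "exp (- min (R1 L K R T) r / T) \<le> 1"
    using R1_nonneg r0 T by (simp add: min_def)
  have slope_Q: "exp (- min (R1 L K R T) r / T) * (c * Q i) \<le> c * Q i" if "c \<ge> 0" for c
    using mult_right_mono[OF slope, of "c * Q i"] Q_nonneg[of i] that by simp
  have tangent: "f y \<le> f r + exp (- min (R1 L K R T) r / T) * (y - r)"
    by (rule fconc_tangent[OF T r0])
  have triangle: "y \<le> norm (z + T *\<^sub>R (p i 0 - p' i 0)) + (11 / 20 * (L * T\<^sup>2) * M i + Q i)"
    using deviation_T[of i] norm_triangle_sub[of "q i T - q' i T" "z + T *\<^sub>R (p i 0 - p' i 0)"]
    by (simp add: q0 z_def y_def)
  have R1: "R1 L K R T = 5/4 * Rt + 5/2 * T" by (simp add: R1_def)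
  have "f y \<le> f r + (if reflects z (\<omega> i) then T * exp (- r / T) * (1 + 11 / 60 * \<bar>s\<bar>) else drift z) + 4 * Q i"
  proof -
    consider "r \<ge> Rt" | "r < Rt" "reflects z (\<omega> i)" | "r < Rt" "\<not> reflects z (\<omega> i)" by linarith
    then show ?thesis
    proof cases
      case 1
      hence nr: "\<not> reflects z (\<omega> i)" by (simp add: reflects_def r_def)
      have "norm (q i T - q' i T) \<le> norm (q i 0 - q' i 0) - K * T\<^sup>2 / 3 * norm (q i 0 - q' i 0) + 4 * Q i"
      proof (rule synchronous_contraction)
        show "p i 0 - p' i 0 = 0" using 1 by (simp add: q0 eta_coup_diff r_def z_def)
        show "M i = norm (q i 0 - q' i 0)" using nr by (simp add: M_def free_bound_def q0 z_def)
        show "6 / 5 * R \<le> norm (q i 0 - q' i 0)" using 1 Rt_ge by (simp add: q0 r_def z_def)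
      qed (use K KT gV_conv in auto)
      hence "y - r \<le> - (K * T\<^sup>2 / 3 * r) + 4 * Q i" by (simp add: y_def q0 r_def z_def)
      hence "exp (- min (R1 L K R T) r / T) * (y - r)
          \<le> exp (- min (R1 L K R T) r / T) * (- (K * T\<^sup>2 / 3 * r)) + exp (- min (R1 L K R T) r / T) * (4 * Q i)"
        unfolding distrib_left[symmetric] by (rule mult_left_mono) simp
      \<comment> \<open>The gain needs a lower bound on the slope, namely \<open>\<theta>\<close>;
        the error \<open>Q i\<close> needs the upper bound 1.\<close>
      moreover have "\<theta> * (K * T\<^sup>2 / 3 * r) \<le> exp (- min (R1 L K R T) r / T) * (K * T\<^sup>2 / 3 * r)"
        using T K r0 unfolding \<theta>_def by (intro mult_right_mono) (auto simp: divide_right_mono)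
      moreover have "drift z = - (\<theta> * (K * T\<^sup>2 / 3 * r))"
        using 1 by (simp add: drift_def r_def)
      ultimately show ?thesis using tangent slope_Q[of 4] nr by simp
    next
      case 2
      have Mi: "M i = r + 2 * T * \<bar>s\<bar>" using 2 by (simp add: M_def free_bound_def r_def s_def z_def)
      have "norm (z + T *\<^sub>R (p i 0 - p' i 0)) \<le> M i"
        using norm_free_le[of T x i x' \<omega>] T by (simp add: q0 z_def M_def)
      moreover have "L * T\<^sup>2 * M i \<le> 3/20 * M i" by (rule mult_right_mono[OF LT M_nonneg])
      ultimately have y: "y \<le> 433/400 * M i + Q i" using triangle by linarith
      \<comment> \<open>The tangent is taken at \<open>R1\<close>, not at \<open>r\<close>: a
        reflected pair may land far away, and only the part beyond \<open>R1\<close> grows with |s|,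
        at slope \<open>\<theta>\<close>. The factor 5/4 in \<open>R1\<close> covers 433/400 r,
        where 433/400 = 1 + 33/400.\<close>
      have "y - R1 L K R T \<le> 11/5 * T * \<bar>s\<bar> + Q i"
      proof -
        define w where "w = T * \<bar>s\<bar>"
        have "w \<ge> 0" "y \<le> 433/400 * (r + 2 * w) + Q i" using T y by (auto simp: w_def Mi mult.assoc)
        hence "y - (5/4 * Rt + 5/2 * T) \<le> 11/5 * w + Q i" using 2 r0 T by argo
        then show ?thesis by (simp add: R1 w_def)
      qed
      hence "\<theta> * (y - R1 L K R T) \<le> \<theta> * (11/5 * T * \<bar>s\<bar>) + \<theta> * Q i"
        unfolding distrib_left[symmetric] using theta_pos by (intro mult_left_mono) auto
      also have "\<theta> * (11/5 * T * \<bar>s\<bar>) \<le> exp (- r / T) / 12 * (11/5 * T * \<bar>s\<bar>)"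
        using theta_le_slope[of r] r0 2 T by (intro mult_right_mono) auto
      also have "\<theta> * Q i \<le> 1 * Q i"
        using theta_le Q_nonneg[of i] by (intro mult_right_mono) auto
      finally have "\<theta> * (y - R1 L K R T) \<le> T * exp (- r / T) * (11/60 * \<bar>s\<bar>) + Q i"
        by (simp add: mult_ac)
      moreover have "f y \<le> f (R1 L K R T) + \<theta> * (y - R1 L K R T)"
        using fconc_tangent[OF T R1_nonneg r0(2), of L K R] by (simp add: \<theta>_def)
      moreover have "f (R1 L K R T) = f r + T * (exp (- r / T) - \<theta>)"
        unfolding \<theta>_def using 2 T r0 by (intro fconc_R1) (auto simp: R1)
      moreover have "T * \<theta> \<ge> 0" using T theta_pos by simp
      ultimately show ?thesis using 2 Q_nonneg[of i] by (simp add: algebra_simps)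
    next
      case 3
      have "Rt > 0" using 3 r0 by linarith
      note g = gamma_bounds[OF this]
      have Mi: "M i = r" using 3 by (simp add: M_def free_bound_def r_def z_def)
      have P0: "p i 0 - p' i 0 = - \<gamma> *\<^sub>R z"
        using 3 by (simp add: q0(3) eta_coup_diff z_def r_def)
      have "z + T *\<^sub>R (- \<gamma> *\<^sub>R z) = (1 - \<gamma> * T) *\<^sub>R z" by (simp add: algebra_simps)
      hence "norm (z + T *\<^sub>R (p i 0 - p' i 0)) = (1 - \<gamma> * T) * r"
        using g by (simp add: r_def P0)
      moreover have "L * T\<^sup>2 * r \<le> 3/20 * (\<gamma> * T) * r" by (rule mult_right_mono[OF g(4) r0(1)])
      moreover have "\<gamma> * T * r \<ge> 0" using g T r0 by simp
      \<comment> \<open>The deviation 33/400 \<gamma> T r costs less than a tenth of the contraction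
        \<gamma> T r.\<close>
      ultimately have "y - r \<le> - (9/10 * (\<gamma> * T) * r) + Q i"
        using triangle unfolding Mi by (simp add: algebra_simps)
      hence "y - r \<le> - (9/10 * (\<gamma> * T) * r) + 1 * Q i" by simp
      hence "exp (- min (R1 L K R T) r / T) * (y - r)
          \<le> exp (- min (R1 L K R T) r / T) * (- (9/10 * (\<gamma> * T) * r)) + exp (- min (R1 L K R T) r / T) * (1 * Q i)"
        unfolding distrib_left[symmetric] by (rule mult_left_mono) simp
      moreover have "min (R1 L K R T) r = r" using 3 T r0 Rt_nonneg by (simp add: R1)
      moreover have "drift z = exp (- r / T) * (- (9/10 * (\<gamma> * T) * r))"
        using 3 by (simp add: drift_def r_def)
      ultimately show ?thesis using tangent slope_Q[of 1] 3 Q_nonneg[of i] by simp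
    qed
  qed
  then show ?thesis unfolding y_def r_def z_def s_def Qe .
qed

section \<open>Averaging over the noise\<close>

text \<open>The 9/10 term refunds the near drift, which a reflected particle does not earn. The term
  with 16 is the interaction error 8 eps Lt T^2 applied to the extra 2 T |s| in
  \<open>free_bound\<close>. The form A + B |s| is the one \<open>reflection_expectation\<close>
  integrates.\<close>

definition reflection_cost :: "'a \<Rightarrow> 'a \<times> real \<Rightarrow> real" where
  "reflection_cost z y = (if reflects z y
     then T * exp (- norm z / T) * (1 + 9 / 10 * (\<gamma> * norm z))
        + (11 / 60 * T * exp (- norm z / T) + 16 * (eps * Lt * T\<^sup>2) * T) * \<bar>e_dir z \<bullet> fst y\<bar> else 0)"

lemma reflection_cost_nonneg: "reflection_cost z y \<ge> 0"
proof (cases "reflects z y")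
  case True
  hence "Rt > 0" unfolding reflects_def using norm_ge_zero[of z] by linarith
  from gamma_bounds(1)[OF this] T interaction_nonneg show ?thesis
    by (simp add: reflection_cost_def)
qed (simp add: reflection_cost_def)

lemma reflection_cost_measurable: "reflection_cost z \<in> borel_measurable particle_noise"
  unfolding reflection_cost_def reflects_def std_normal_density_ratio by measurable

lemma sum_fconc_step:
  fixes x x' :: "'n::finite \<Rightarrow> 'a"
  assumes fl: "is_ham_flow grad x (\<lambda>i. fst (\<omega> i)) q p"
    and fl': "is_ham_flow grad x' (eta_coup L K R T x x' \<omega>) q' p'"
  shows "(\<Sum>i\<in>UNIV. f (norm (q i T - q' i T))) \<le> (\<Sum>i\<in>UNIV.
     (f (norm (x i - x' i)) + drift (x i - x' i) + 8 * (eps * Lt * T\<^sup>2) * norm (x i - x' i))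
     + reflection_cost (x i - x' i) (\<omega> i))"
proof -
  let ?z = "\<lambda>i. x i - x' i" and ?E = "eps * Lt * T\<^sup>2"
  define M where "M i = free_bound (?z i) (\<omega> i)" for i
  define D where "D i = (if reflects (?z i) (\<omega> i)
       then T * exp (- norm (?z i) / T) * (1 + 11 / 60 * \<bar>e_dir (?z i) \<bullet> fst (\<omega> i)\<bar>)
       else drift (?z i))" for i
  have "(\<Sum>i\<in>UNIV. f (norm (q i T - q' i T)))
      \<le> (\<Sum>i\<in>UNIV. f (norm (?z i)) + D i + 4 * (?E * (M i + (\<Sum>j\<in>UNIV. M j) / real CARD('n))))"
    unfolding D_def M_def by (intro sum_mono fconc_step[OF fl fl'])
  also have "\<dots> = (\<Sum>i\<in>UNIV. f (norm (?z i)) + D i + 8 * ?E * M i)"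
  proof -
    \<comment> \<open>The average contributes as much to the sum as the individual terms, which
      doubles 4 to 8.\<close>
    have "(\<Sum>i\<in>UNIV. 4 * (?E * (M i + (\<Sum>j\<in>UNIV. M j) / real CARD('n)))) = 8 * ?E * (\<Sum>j\<in>UNIV. M j)"
      unfolding sum_distrib_left[symmetric] by (simp add: sum.distrib)
    also have "\<dots> = (\<Sum>i\<in>UNIV. 8 * ?E * M i)" by (rule sum_distrib_left)
    finally show ?thesis by (simp only: sum.distrib)
  qed
  also have "\<dots> \<le> (\<Sum>i\<in>UNIV.
     (f (norm (?z i)) + drift (?z i) + 8 * ?E * norm (?z i)) + reflection_cost (?z i) (\<omega> i))"
  proof (rule sum_mono)
    fix i
    show "f (norm (?z i)) + D i + 8 * ?E * M i
        \<le> (f (norm (?z i)) + drift (?z i) + 8 * ?E * norm (?z i)) + reflection_cost (?z i) (\<omega> i)"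
    proof (cases "reflects (?z i) (\<omega> i)")
      case True
      hence "drift (?z i) = - (9 / 10 * (\<gamma> * T) * norm (?z i) * exp (- norm (?z i) / T))"
        by (simp add: drift_def reflects_def)
      then show ?thesis using True
        by (simp add: D_def M_def free_bound_def reflection_cost_def algebra_simps)
    qed (simp add: D_def M_def free_bound_def reflection_cost_def)
  qed
  finally show ?thesis .
qed

text \<open>The bound of \<open>reflection_expectation\<close> for g = \<gamma> |z|, with
  \<open>A\<close> and \<open>B\<close> read off from \<open>reflection_cost\<close>.\<close>

definition mean_cost :: "'a \<Rightarrow> real" where
  "mean_cost z = (if norm z \<ge> Rt then 0 else \<gamma> * norm z *
     (21 / 40 * (T * exp (- norm z / T) * (1 + 9 / 10 * (\<gamma> * norm z)))
     + 11 / 10 * (11 / 60 * T * exp (- norm z / T) + 16 * (eps * Lt * T\<^sup>2) * T)))"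

lemma mean_cost_nonneg: "mean_cost z \<ge> 0"
proof (cases "norm z \<ge> Rt")
  case False
  hence Rt: "Rt > 0" using norm_ge_zero[of z] by linarith
  let ?A = "T * exp (- norm z / T) * (1 + 9 / 10 * (\<gamma> * norm z))"
  let ?B = "11 / 60 * T * exp (- norm z / T) + 16 * (eps * Lt * T\<^sup>2) * T"
  have g: "0 \<le> \<gamma> * norm z" using gamma_bounds(1)[OF Rt] by simp
  have AB: "0 \<le> ?A" "0 \<le> ?B" using g T interaction_nonneg by simp_all
  have "0 \<le> 21 / 40 * ?A + 11 / 10 * ?B"
    by (rule add_nonneg_nonneg[OF mult_nonneg_nonneg[OF _ AB(1)] mult_nonneg_nonneg[OF _ AB(2)]]) simp_all
  from mult_nonneg_nonneg[OF g this] False show ?thesis by (simp only: mean_cost_def if_False)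
qed (simp add: mean_cost_def)

lemma nn_integral_reflection_cost:
  "(\<integral>\<^sup>+y. ennreal (reflection_cost z y) \<partial>particle_noise) \<le> ennreal (mean_cost z)"
proof (cases "norm z \<ge> Rt")
  case True
  hence "reflection_cost z y = 0" for y by (simp add: reflection_cost_def reflects_def)
  then show ?thesis by simp
next
  case False
  hence Rt: "Rt > 0" using norm_ge_zero[of z] by linarith
  note g = gamma_bounds[OF Rt]
  let ?A = "T * exp (- norm z / T) * (1 + 9 / 10 * (\<gamma> * norm z))"
  let ?B = "11 / 60 * T * exp (- norm z / T) + 16 * (eps * Lt * T\<^sup>2) * T"
  have "\<gamma> * norm z \<le> \<gamma> * Rt" using False g by (intro mult_left_mono) auto
  also note g(3)
  finally have gz: "0 \<le> \<gamma> * norm z" "\<gamma> * norm z \<le> 1/4" using g(1) by simp_all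
  have AB: "?A \<ge> 0" "?B \<ge> 0" using gz T interaction_nonneg by auto
  have "reflection_cost z y = (if snd y \<le> std_normal_density (e_dir z \<bullet> fst y + \<gamma> * norm z) / std_normal_density (e_dir z \<bullet> fst y)
      then 0 else ?A + ?B * \<bar>e_dir z \<bullet> fst y\<bar>)" for y
    using False by (simp add: reflection_cost_def reflects_def)
  then show ?thesis
    using reflection_expectation[OF norm_e_dir[of z] gz AB] False by (simp add: mean_cost_def)
qed

text \<open>Far from 0 the gain 1/3 exceeds 5/96 + 1/12, in units of K T^2 \<open>\<theta>\<close>
  r. Near 0, with \<gamma> r <= 1/4, the gain 9/10 exceeds 21/40 + 189/1600 + 121/600, in units of
  \<gamma> T r exp (- r / T), and what remains covers the interaction and the rate.\<close>

lemma particle_balance: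
  "f (norm z) + drift z + 8 * (eps * Lt * T\<^sup>2) * norm z + mean_cost z
     \<le> (1 - K * T\<^sup>2 / 156 * exp (- 5 * Rt / (4 * T))) * f (norm z)"
proof -
  define r where "r = norm z"
  define E where "E = eps * Lt * T\<^sup>2"
  define k where "k = K * T\<^sup>2"
  have r0: "r \<ge> 0" by (simp add: r_def)
  have k: "k \<ge> 0" "k \<le> 3/80" using K KT by (auto simp: k_def)
  have E: "E \<ge> 0" "E \<le> 5/64 * k * \<theta>\<^sup>2" using interaction_nonneg interaction_strength by (auto simp: E_def k_def)
  \<comment> \<open>As f r <= r, it suffices to contract by a multiple of the distance
    itself.\<close>
  have "k / 156 * exp (- 5 * Rt / (4 * T)) * f r \<le> (k * \<theta> / 12) * r"
    using contraction_rate_le fconc_le[OF T R1_nonneg r0] fconc_nonneg[of L K R T r] theta_pos k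
    by (intro mult_mono) (auto simp: k_def)
  moreover have "drift z + 8 * E * r + mean_cost z \<le> - (k * \<theta> / 12 * r)"
  proof (cases "r \<ge> Rt")
    case True
    have "\<theta> * \<theta> \<le> 1/12 * \<theta>" using theta_le theta_pos by (intro mult_right_mono) auto
    hence "k * (\<theta> * \<theta>) \<le> k * (1/12 * \<theta>)" using k by (intro mult_left_mono) auto
    hence "8 * E \<le> 5/96 * (k * \<theta>)" using E(2) by (simp add: power2_eq_square)
    hence "8 * E * r \<le> 5/96 * (k * \<theta>) * r" using r0 by (rule mult_right_mono)
    moreover have "drift z = - (1/3 * (k * \<theta>) * r)" "mean_cost z = 0"
      using True by (auto simp: drift_def mean_cost_def r_def k_def)
    moreover have "k * \<theta> * r \<ge> 0" using k theta_pos r0 by simp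
    ultimately show ?thesis by simp
  next
    case False
    hence Rt: "Rt > 0" using r0 by linarith
    note g = gamma_bounds[OF Rt]
    define h where "h = exp (- r / T)"
    define u where "u = \<gamma> * T * r * h"
    have h: "h > 0" by (simp add: h_def)
    have u0: "u \<ge> 0" using g T r0 h by (simp add: u_def)
    have th: "\<theta> \<le> h / 12" using theta_le_slope[of r] r0 False by (simp add: h_def)
    have kg: "k \<le> 3/80 * (\<gamma> * T)" using mult_right_mono[OF K_le, of "T\<^sup>2"] g(4) by (simp add: k_def)
    have "h \<le> 1" using r0 T by (simp add: h_def)
    have "\<gamma> * r \<le> \<gamma> * Rt" using False g by (intro mult_left_mono) auto
    also note g(3)
    finally have gr: "\<gamma> * r \<le> 1/4" .
    have "\<theta>\<^sup>2 \<le> \<theta> * (1/12)" unfolding power2_eq_square using theta_le theta_pos by (intro mult_left_mono) auto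
    hence th2: "\<theta>\<^sup>2 \<le> h / 144" using th by simp
    have "k * \<theta>\<^sup>2 \<le> (3/80 * (\<gamma> * T)) * (h / 144)"
      using kg th2 k g T by (intro mult_mono) auto
    also have "\<dots> = 1/3840 * (\<gamma> * T * h)" by simp
    finally have "k * \<theta>\<^sup>2 \<le> 1/3840 * (\<gamma> * T * h)" .
    moreover have "\<gamma> * T * h \<ge> 0" using g T h by simp
    \<comment> \<open>(5/64) / 3840 is below 1/45000.\<close>
    ultimately have Eh: "E \<le> 1/45000 * (\<gamma> * T * h)" using E(2) by linarith
    have 1: "8 * E * r \<le> 8/45000 * u"
      using mult_right_mono[OF Eh r0] by (simp add: u_def algebra_simps)
    have 2: "E * (\<gamma> * T * r) \<le> 1/45000 * u"
    proof -
      have "1/45000 * (\<gamma> * T * h) \<le> 1/45000 * (1 * h)"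
        using g h by (intro mult_left_mono mult_right_mono) auto
      hence "E \<le> 1/45000 * h" using Eh by simp
      from mult_right_mono[OF this, of "\<gamma> * T * r"] show ?thesis
        using g T r0 by (simp add: u_def algebra_simps)
    qed
    have 3: "u * (\<gamma> * r) \<le> u * (1/4)" using gr u0 by (rule mult_left_mono)
    \<comment> \<open>189/400 = (21/40) (9/10), 121/600 = (11/10) (11/60) and 88/5 = (11/10)
      16.\<close>
    have m: "mean_cost z = 21/40 * u + 189/400 * (u * (\<gamma> * r)) + 121/600 * u + 88/5 * (E * (\<gamma> * T * r))"
      using False by (simp add: mean_cost_def u_def h_def E_def r_def algebra_simps)
    have d: "drift z = - (9/10 * u)" using False by (simp add: drift_def u_def h_def r_def)
    have "k * \<theta> \<le> (3/80 * (\<gamma> * T)) * (h / 12)"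
      using kg th k g T theta_pos by (intro mult_mono) auto
    from mult_right_mono[OF this r0] have "k * \<theta> * r \<le> 1/320 * u"
      by (simp add: u_def algebra_simps)
    then show ?thesis using 1 2 3 u0 unfolding m d by simp
  qed
  ultimately show ?thesis unfolding r_def[symmetric] E_def[symmetric] k_def[symmetric] by (simp add: algebra_simps)
qed

lemma expected_contraction:
  fixes x x' :: "'n::finite \<Rightarrow> 'a"
  shows "(\<integral>\<^sup>+ \<omega>. ennreal (1 / real CARD('n) *
            (\<Sum>i\<in>UNIV. rho L K R T (ham_q grad x (\<lambda>i. fst (\<omega> i)) T i)
                             (ham_q grad x' (eta_coup L K R T x x' \<omega>) T i)))
          \<partial>(noise :: ('n \<Rightarrow> 'a \<times> real) measure))
       \<le> ennreal ((1 - K * T\<^sup>2 / 156 * exp (- 5 * Rt / (4 * T)))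
            * (1 / real CARD('n) * (\<Sum>i\<in>UNIV. rho L K R T (x i) (x' i))))"
proof -
  let ?c = "\<lambda>i. f (norm (x i - x' i)) + drift (x i - x' i) + 8 * (eps * Lt * T\<^sup>2) * norm (x i - x' i)"
  let ?F = "\<lambda>\<omega>. 1 / real CARD('n) * (\<Sum>i\<in>UNIV. rho L K R T (ham_q grad x (\<lambda>i. fst (\<omega> i)) T i)
                             (ham_q grad x' (eta_coup L K R T x x' \<omega>) T i))"
  have "(\<integral>\<^sup>+ \<omega>. ennreal (?F \<omega>) \<partial>(noise :: ('n \<Rightarrow> 'a \<times> real) measure))
      \<le> ennreal (1 / real CARD('n) * (\<Sum>i\<in>UNIV. ?c i + mean_cost (x i - x' i)))"
  proof (rule nn_integral_noise_sum_bound[where h = "\<lambda>i. reflection_cost (x i - x' i)"])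
    fix \<omega> :: "'n \<Rightarrow> 'a \<times> real"
    show "0 \<le> ?F \<omega>" by (intro mult_nonneg_nonneg sum_nonneg) (auto simp: rho_def fconc_nonneg)
    have C: "0 \<le> L + 2 * (eps * Lt)" using L eps Lt by simp
    obtain q p where fl: "is_ham_flow grad x (\<lambda>i. fst (\<omega> i)) q p"
      and q: "\<And>t. ham_q grad x (\<lambda>i. fst (\<omega> i)) t = (\<lambda>i. q i t)"
      using ham_q_is_ham_flow[where G = grad, OF grad_lipschitz C] by blast
    obtain q' p' where fl': "is_ham_flow grad x' (eta_coup L K R T x x' \<omega>) q' p'"
      and q': "\<And>t. ham_q grad x' (eta_coup L K R T x x' \<omega>) t = (\<lambda>i. q' i t)"
      using ham_q_is_ham_flow[where G = grad, OF grad_lipschitz C] by blast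
    show "?F \<omega> \<le> 1 / real CARD('n) * (\<Sum>i\<in>UNIV. ?c i + reflection_cost (x i - x' i) (\<omega> i))"
      unfolding q q' rho_def by (intro mult_left_mono sum_fconc_step[OF fl fl']) simp
  qed (auto intro: reflection_cost_nonneg reflection_cost_measurable nn_integral_reflection_cost mean_cost_nonneg)
  also have "\<dots> \<le> ennreal (1 / real CARD('n) *
      (\<Sum>i\<in>UNIV. (1 - K * T\<^sup>2 / 156 * exp (- 5 * Rt / (4 * T))) * f (norm (x i - x' i))))"
    by (intro ennreal_leI mult_left_mono sum_mono particle_balance) simp
  also have "\<dots> = ennreal ((1 - K * T\<^sup>2 / 156 * exp (- 5 * Rt / (4 * T)))
            * (1 / real CARD('n) * (\<Sum>i\<in>UNIV. rho L K R T (x i) (x' i))))"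
    by (simp add: rho_def sum_distrib_left[symmetric] mult.left_commute)
  finally show ?thesis .
qed

end

text \<open>Truncation by \<open>ennreal\<close> loses nothing: \<open>rho\<close> is nonnegative,
  and the factor on the right is positive because K T^2 <= 3/80.\<close>

theorem mainTheorem16:
  fixes V :: "'a::euclidean_space \<Rightarrow> real" and W :: "'a \<Rightarrow> 'a \<Rightarrow> real"
    and gV :: "'a \<Rightarrow> 'a" and gW :: "'a \<Rightarrow> 'a \<Rightarrow> 'a"
    and L K R Lt T eps :: real and x x' :: "'n::finite \<Rightarrow> 'a"
  assumes "L > 0" and "K > 0" and "R \<ge> 0" and "Lt \<ge> 0"
    and dV: "\<And>y. GDERIV V y :> gV y"
    and dW1: "\<And>y w. GDERIV (\<lambda>z. W z w) y :> gW y w"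
    and C1W: "\<And>y w. (\<lambda>p. W (fst p) (snd p)) differentiable (at (y, w))"
    and "V 0 = 0" and "\<And>y. V y \<ge> 0"
    and "\<And>y w. norm (gV y - gV w) \<le> L * norm (y - w)"
    and "\<And>y w. norm (y - w) \<ge> R \<Longrightarrow>
           inner (y - w) (gV y - gV w) \<ge> K * (norm (y - w))\<^sup>2 + (norm (gV y - gV w))\<^sup>2 / L"
    and "\<And>y w. W y w = W w y"
    and "\<And>y w y' w'. norm (gW y w - gW y' w') \<le> Lt * (norm (y - y') + norm (w - w'))"
    and "T > 0" and "eps \<ge> 0"
    and "L * T\<^sup>2 \<le> 3 / 5 * (if Rtil L K R = 0 then 1 / 4
                              else min (1 / 4) (3 / (1280 * L * (Rtil L K R)\<^sup>2)))"
    and "eps * Lt \<le> 5 / 64 * (K / sqrt (7 / 6 + 3 / (2 * K * T\<^sup>2)))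
                      * exp (- 5 * Rtil L K R / (2 * T) - 5)"
  shows "(\<integral>\<^sup>+ \<omega>. ennreal (1 / real CARD('n) *
            (\<Sum>i\<in>UNIV. rho L K R T (coupX V W eps T x \<omega> i) (coupX' V W eps L K R T x x' \<omega> i)))
          \<partial>(noise :: ('n \<Rightarrow> 'a \<times> real) measure))
       \<le> ennreal ((1 - K * T\<^sup>2 / 156 * exp (- 5 * Rtil L K R / (4 * T)))
            * (1 / real CARD('n) * (\<Sum>i\<in>UNIV. rho L K R T (x i) (x' i))))"
proof -
  interpret xhmc_coupling gV gW L K R Lt T eps
    by unfold_locales (use assms in auto)
  have "gradU V W eps = (grad :: ('n \<Rightarrow> 'a) \<Rightarrow> 'n \<Rightarrow> 'a)"
  proof (intro ext)
    fix y :: "'n \<Rightarrow> 'a" and i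
    show "gradU V W eps y i = grad y i"
      unfolding grad_def by (rule gradU_eq[OF dV dW1 C1W \<open>\<And>y w. W y w = W w y\<close>])
  qed
  then show ?thesis
    unfolding coupX_def coupX'_def using expected_contraction[of x x'] by simp
qed

end
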